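(* Let $n \geq 1$ be an integer and let $a, b \colon \mathbb{C}^{n+1} \to \mathbb{C}$ be holomorphic functions. Then the variety $$X_{a,b} = \{ (x,y,z) \in \mathbb{C} \times \mathbb{C} \times \mathbb{C}^{n+1} \,:\, x^2 y = a(z) + x\, b(z) \} \subset \mathbb{C}^{n+3}, \qquad z = (z_0, \dots, z_n),$$ contains a very tame sequence with respect to the holomorphic volume form $\omega = \frac{dx}{x^2} \wedge dz_0 \wedge \dots \wedge dz_n$. In particular, the Koras--Russell cubic threefold $C = \{ (x,y,z,w) \in \mathbb{C}^4 \,:\, x^2 y + x + z^2 + w^3 = 0 \}$ contains a very tame sequence with respect to the holomorphic volume form $\omega = \frac{dx}{x^2} \wedge dz \wedge dw$.
   Context: Let $X$ be a complex manifold (or, as allowed here, a possibly singular complex variety), and let $\mathrm{Aut}(X)$ be its group of holomorphic automorphisms. For a subgroup $G \subseteq \mathrm{Aut}(X)$, a closed discrete infinite set $A \subset X$ is called $G$-tame if for every injective mapping $f \colon A \to A$ there exists $F \in G$ such that $F|_A = f$. If $X$ carries a holomorphic volume form $\omega$, a very tame set (or very tame sequence) with respect to $\omega$ is a $G$-tame set where $G$ is the group of all $F \in \mathrm{Aut}(X)$ preserving $\omega$, i.e. $F^*\omega = \omega$. The variety $X_{a,b}$ is allowed to be singular; in that case $\omega$ is considered on the regular part. *)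

theory Defs
  imports "HOL-Analysis.Analysis"
begin

section \<open>Holomorphic functions of several variables\<close>

definition hol_fun_on :: "(complex^'m) set \<Rightarrow> (complex^'m \<Rightarrow> complex) \<Rightarrow> bool" where
  "hol_fun_on U f \<longleftrightarrow>
     (\<forall>p\<in>U. \<exists>D. (f has_derivative D) (at p) \<and> (\<forall>c v. D (c *s v) = c * D v))"

definition hol_map_on :: "(complex^'m) set \<Rightarrow> (complex^'m \<Rightarrow> complex^'k) \<Rightarrow> bool" where
  "hol_map_on U F \<longleftrightarrow> (\<forall>i. hol_fun_on U (\<lambda>p. F p $ i))"

section \<open>Subvarieties of affine space, their regular points and tangent vectors\<close>

definition regular_at :: "nat \<Rightarrow> (complex^'m) set \<Rightarrow> complex^'m \<Rightarrow> bool" where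
  "regular_at d X p \<longleftrightarrow> p \<in> X \<and>
     (\<exists>U V. \<exists>\<phi> :: complex^'m \<Rightarrow> complex^'m. \<exists>I. open U \<and> p \<in> U \<and> open V \<and> bij_betw \<phi> U V \<and>
        hol_map_on U \<phi> \<and> hol_map_on V (inv_into U \<phi>) \<and>
        card I = d \<and> \<phi> ` (X \<inter> U) = {w \<in> V. \<forall>i. i \<notin> I \<longrightarrow> w $ i = 0})"

text \<open>The dimension is a parameter. For a variety of pure dimension \<open>d\<close>, such as a
  hypersurface in a space of dimension \<open>d + 1\<close>, every regular point has local dimension \<open>d\<close>,
  and this is the whole regular part.\<close>
definition regular_part :: "nat \<Rightarrow> (complex^'m) set \<Rightarrow> (complex^'m) set" where
  "regular_part d X = {p. regular_at d X p}"

text \<open>Tangent vectors are the velocities of holomorphic discs in \<open>X\<close>. This is used at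
  regular points only, where it gives the usual tangent space.\<close>
definition tangent_vectors :: "(complex^'m) set \<Rightarrow> complex^'m \<Rightarrow> (complex^'m) set" where
  "tangent_vectors X p =
     {v. \<exists>r>0. \<exists>\<gamma> :: complex \<Rightarrow> complex^'m.
        (\<forall>i. (\<lambda>t. \<gamma> t $ i) holomorphic_on ball 0 r) \<and> \<gamma> ` ball 0 r \<subseteq> X \<and>
        \<gamma> 0 = p \<and> (\<forall>i. v $ i = deriv (\<lambda>t. \<gamma> t $ i) 0)}"

section \<open>Automorphisms\<close>

text \<open>As usual on a reduced, possibly singular variety, a map is holomorphic if it is locally
  the restriction of a holomorphic map of the ambient space.\<close>
definition local_extension ::
    "(complex^'m) set \<Rightarrow> (complex^'m \<Rightarrow> complex^'k) \<Rightarrow> complex^'m \<Rightarrow>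
     (complex^'m) set \<Rightarrow> (complex^'m \<Rightarrow> complex^'k) \<Rightarrow> bool" where
  "local_extension X F p U G \<longleftrightarrow>
     open U \<and> p \<in> U \<and> hol_map_on U G \<and> (\<forall>q\<in>X \<inter> U. F q = G q)"

definition hol_map_variety :: "(complex^'m) set \<Rightarrow> (complex^'m \<Rightarrow> complex^'k) \<Rightarrow> bool" where
  "hol_map_variety X F \<longleftrightarrow> (\<forall>p\<in>X. \<exists>U G. local_extension X F p U G)"

text \<open>Elements are total functions whose values outside \<open>X\<close> are irrelevant.\<close>
definition Aut :: "(complex^'m) set \<Rightarrow> (complex^'m \<Rightarrow> complex^'m) set" where
  "Aut X = {F. bij_betw F X X \<and> hol_map_variety X F \<and> hol_map_variety X (inv_into X F)}"

text \<open>The derivative of a local extension depends on the extension, but its values on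
  tangent vectors of \<open>X\<close> do not; it is only ever applied to these.\<close>
definition differential ::
    "(complex^'m) set \<Rightarrow> (complex^'m \<Rightarrow> complex^'k) \<Rightarrow> complex^'m \<Rightarrow> complex^'m \<Rightarrow> complex^'k" where
  "differential X F p =
     (SOME D. \<exists>U G. local_extension X F p U G \<and> (G has_derivative D) (at p))"

section \<open>Volume forms\<close>

text \<open>A form of degree \<open>CARD('k)\<close> assigns to a point and to tangent vectors indexed by \<open>'k\<close> a
  complex number; its values on other vectors are irrelevant. Indexing the covectors by the
  same type \<open>'k\<close> makes an ordering of \<open>'k\<close> unnecessary: permuting covectors and
  arguments simultaneously does not change the determinant.\<close>
type_synonym ('m, 'k) form = "complex^'m \<Rightarrow> ('k \<Rightarrow> complex^'m) \<Rightarrow> complex"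

text \<open>The wedge product of the coordinate differentials numbered \<open>J j\<close>, \<open>j :: 'k\<close>.\<close>
definition coord_wedge :: "('k::finite \<Rightarrow> 'm) \<Rightarrow> ('k \<Rightarrow> complex^'m) \<Rightarrow> complex" where
  "coord_wedge J v = det (\<chi> i j. v i $ J j)"

text \<open>Holomorphic forms on the regular part are locally restrictions of holomorphic forms of
  the ambient space. The sum runs over all \<open>J\<close>, so that each product of coordinate
  differentials is repeated up to sign.\<close>
definition holomorphic_form :: "(complex^'m) set \<Rightarrow> ('m::finite, 'k::finite) form \<Rightarrow> bool" where
  "holomorphic_form X \<omega> \<longleftrightarrow>
     (\<forall>p\<in>regular_part CARD('k) X. \<exists>U c.
        open U \<and> p \<in> U \<and> (\<forall>J :: 'k \<Rightarrow> 'm. hol_fun_on U (c J)) \<and>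
        (\<forall>q\<in>regular_part CARD('k) X \<inter> U. \<forall>v. (\<forall>k. v k \<in> tangent_vectors X q) \<longrightarrow>
           \<omega> q v = (\<Sum>J\<in>UNIV. c J q * coord_wedge J v)))"

definition holomorphic_volume_form :: "(complex^'m) set \<Rightarrow> ('m::finite, 'k::finite) form \<Rightarrow> bool" where
  "holomorphic_volume_form X \<omega> \<longleftrightarrow> holomorphic_form X \<omega> \<and>
     (\<forall>p\<in>regular_part CARD('k) X. \<exists>v. (\<forall>k. v k \<in> tangent_vectors X p) \<and> \<omega> p v \<noteq> 0)"

definition pullback ::
    "(complex^'m) set \<Rightarrow> (complex^'m \<Rightarrow> complex^'m) \<Rightarrow> ('m, 'k) form \<Rightarrow> ('m, 'k) form" where
  "pullback X F \<omega> p v = \<omega> (F p) (\<lambda>k. differential X F p (v k))"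

definition volume_group ::
    "(complex^'m) set \<Rightarrow> ('m::finite, 'k::finite) form \<Rightarrow> (complex^'m \<Rightarrow> complex^'m) set" where
  "volume_group X \<omega> = {F \<in> Aut X. \<forall>p\<in>regular_part CARD('k) X. \<forall>v.
     (\<forall>k. v k \<in> tangent_vectors X p) \<longrightarrow> pullback X F \<omega> p v = \<omega> p v}"

section \<open>Tame sets\<close>

definition tame :: "(complex^'m \<Rightarrow> complex^'m) set \<Rightarrow> (complex^'m) set \<Rightarrow> (complex^'m) set \<Rightarrow> bool" where
  "tame G X A \<longleftrightarrow> closedin (top_of_set X) A \<and> discrete A \<and> infinite A \<and>
     (\<forall>f. f ` A \<subseteq> A \<and> inj_on f A \<longrightarrow> (\<exists>F\<in>G. \<forall>p\<in>A. F p = f p))"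

definition very_tame :: "(complex^'m) set \<Rightarrow> ('m::finite, 'k::finite) form \<Rightarrow> (complex^'m) set \<Rightarrow> bool" where
  "very_tame X \<omega> A \<longleftrightarrow> tame (volume_group X \<omega>) X A"

section \<open>The varieties\<close>

text \<open>Coordinates \<open>x\<close>, \<open>y\<close> and \<open>z i\<close>, where \<open>i\<close> ranges over the index type of \<open>z\<close>.\<close>
datatype 'n coord = Cx | Cy | Cz 'n

instance coord :: (finite) finite
proof
  have "(UNIV :: 'a coord set) = {Cx, Cy} \<union> range Cz"
    by (auto intro: coord.exhaust)
  then show "finite (UNIV :: 'a coord set)"
    by (metis finite.emptyI finite.insertI finite_UnI finite_imageI finite)
qed

definition X_var :: "(complex^'n \<Rightarrow> complex) \<Rightarrow> (complex^'n \<Rightarrow> complex) \<Rightarrow> (complex^('n coord)) set" where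
  "X_var a b = {p. let x = p $ Cx; y = p $ Cy; z = (\<chi> i. p $ Cz i) in x^2 * y = a z + x * b z}"

definition Koras_Russell :: "(complex^(2 coord)) set" where
  "Koras_Russell =
     {p. let x = p $ Cx; y = p $ Cy; z = p $ Cz 1; w = p $ Cz 2 in x^2 * y + x + z^2 + w^3 = 0}"

text \<open>\<open>\<omega>\<close> is the holomorphic volume form \<open>dx / x^2 \<and> dz\<close>. The formula makes sense only where
  \<open>x\<close> is nonzero; at the regular points with \<open>x = 0\<close> the form is its holomorphic extension.
  That extension is unique unless \<open>X\<close> has \<open>{x = 0}\<close> as a component, i.e. unless \<open>a = 0\<close>.
  The index \<open>None\<close> carries \<open>dx\<close> and \<open>Some i\<close> carries the differential of \<open>z i\<close>.\<close>
definition is_omega :: "(complex^('n::finite coord)) set \<Rightarrow> ('n coord, 'n option) form \<Rightarrow> bool" where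
  "is_omega X \<omega> \<longleftrightarrow> holomorphic_volume_form X \<omega> \<and>
     (\<forall>p\<in>regular_part CARD('n option) X. p $ Cx \<noteq> 0 \<longrightarrow>
        (\<forall>v. (\<forall>k. v k \<in> tangent_vectors X p) \<longrightarrow>
           \<omega> p v = coord_wedge (case_option Cx Cz) v / (p $ Cx)^2))"

end

theory Submission
  imports Defs "HOL-Complex_Analysis.Great_Picard"
begin

text \<open>
  Why such a sequence exists. On the part of \<open>X = X_var a b\<close> where \<open>x \<noteq> 0\<close>, the coordinate \<open>y\<close> is a
  function of \<open>x\<close> and \<open>z\<close>, and \<open>\<omega>\<close> is \<open>dx \<and> dz / x^2\<close>. Hence a map that fixes \<open>x\<close> and shears \<open>z\<close>
  preserves \<open>\<omega>\<close>. If the shear moves \<open>z\<close> only by a multiple of \<open>x^2\<close>, say from \<open>z\<close> to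
  \<open>z + x^2 g(z j) e_i\<close> with \<open>i \<noteq> j\<close> and \<open>g\<close> entire, then \<open>a(z) + x b(z)\<close> changes by a multiple of
  \<open>x^2\<close>, and a suitable change of \<open>y\<close> compensates for it. This gives an automorphism of the whole
  ambient space that preserves \<open>x^2 y - a(z) - x b(z)\<close> (\<open>eqn_shear\<close>). In the slice \<open>x = 1\<close> these are
  the ordinary shears of the \<open>z\<close>-space, and the tame sequence consists of the points of this slice
  with \<open>z = m e_i\<close>, \<open>m\<close> a natural number. As for the integers in affine space (Rosay and Rudin),
  three shears realise any injection \<open>\<sigma>\<close> of the sequence: write \<open>\<sigma> m\<close> into a second coordinate,
  use it to replace \<open>m\<close> by \<open>\<sigma> m\<close> in the first, and erase the second (\<open>injection_extends\<close>). The
  entire functions come from interpolation at the natural numbers.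

  The remaining work takes place over \<open>x = 0\<close>. There a regular point is either a limit of points
  with \<open>x \<noteq> 0\<close>, and then equality of the two forms extends to it by continuity, or \<open>X\<close> coincides
  nearby with the hyperplane \<open>x = 0\<close>; in this case \<open>a\<close> vanishes nearby by Hurwitz's theorem
  (\<open>locally_x_eq_0\<close>), and the shear is the identity there. So every admissible \<open>\<omega>\<close> is preserved.

  The form itself is the Poincare residue of \<open>dx \<and> dy \<and> dz / f\<close> with
  \<open>f = x^2 y - a(z) - x b(z)\<close>: up to sign, the product of the coordinate differentials other
  than that of \<open>k\<close>, divided by the partial derivative of \<open>f\<close> along \<open>k\<close>, for any \<open>k\<close> for which this is nonzero. What
  makes it a volume form on all of the regular part is \<open>gradient_vanishes_nearby\<close>: if the gradient
  of an equation vanishes at a regular point, then it vanishes on a whole neighbourhood in \<open>X\<close>.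
  For \<open>f\<close> the neighbourhood then lies in \<open>x = 0\<close>, where \<open>dy \<and> dz\<close> serves as the form.

  All functions of several variables are handled through one-variable slices and Osgood's lemma.
\<close>

section \<open>Osgood's lemma\<close>

definition dir_deriv :: "(complex^'m \<Rightarrow> complex) \<Rightarrow> complex^'m \<Rightarrow> complex^'m \<Rightarrow> complex" where
  "dir_deriv f v p = deriv (\<lambda>t. f (p + t *s v)) 0"

text \<open>
  Differentiability on the complex line through each point in one fixed direction. Separate
  holomorphy is the conjunction over the coordinate directions, and it is the form in which
  one-variable theorems are applied.
\<close>
definition differentiable_along :: "(complex^'m) set \<Rightarrow> complex^'m \<Rightarrow> (complex^'m \<Rightarrow> complex) \<Rightarrow> bool" where
  "differentiable_along U v f \<longleftrightarrow> (\<forall>p\<in>U. (\<lambda>t. f (p + t *s v)) field_differentiable at 0)"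

lemma norm_smult_vec: "norm (c *s v) = norm c * norm (v :: complex^'m)"
  by (simp add: norm_vec_def L2_set_def norm_mult power_mult_distrib flip: sum_distrib_left)
     (simp add: real_sqrt_mult)

lemma bounded_linear_smult_left: "bounded_linear (\<lambda>t. t *s (v :: complex^'m))"
proof (rule bounded_linear_intro[of _ "norm v"])
  show "(r *\<^sub>R t) *s v = r *\<^sub>R (t *s v)" for r :: real and t
    by (simp add: vec_eq_iff)
qed (auto simp: vec_eq_iff algebra_simps norm_smult_vec)

lemma continuous_on_smult_left [continuous_intros]:
  "continuous_on S f \<Longrightarrow> continuous_on S (\<lambda>t. f t *s (v :: complex^'m))"
  by (rule bounded_linear.continuous_on[OF bounded_linear_smult_left])

lemma slice_DERIV:
  assumes "differentiable_along U v f" "p + t0 *s v \<in> U"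
  shows "((\<lambda>t. f (p + t *s v)) has_field_derivative dir_deriv f v (p + t0 *s v)) (at t0)"
proof -
  have "((\<lambda>t. f (p + t0 *s v + t *s v)) has_field_derivative dir_deriv f v (p + t0 *s v)) (at 0)"
    using assms unfolding differentiable_along_def dir_deriv_def by (simp add: field_differentiable_derivI)
  moreover have "(\<lambda>t. f (p + t0 *s v + t *s v)) = (\<lambda>t. f (p + (t + t0) *s v))"
    by (simp add: algebra_simps vec_eq_iff fun_eq_iff)
  ultimately show ?thesis
    using DERIV_shift[of "\<lambda>t. f (p + t *s v)" "dir_deriv f v (p + t0 *s v)" 0 t0] by simp
qed

lemma slice_holomorphic:
  assumes "differentiable_along U v f" "\<And>t. t \<in> S \<Longrightarrow> p + t *s v \<in> U"
  shows "(\<lambda>t. f (p + t *s v)) holomorphic_on S"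
  unfolding holomorphic_on_def field_differentiable_def
  using slice_DERIV[OF assms(1) assms(2)] has_field_derivative_at_within by blast

lemma slice_increment:
  assumes "differentiable_along U v f" "\<And>s. s \<in> closed_segment 0 t \<Longrightarrow> p + s *s v \<in> U"
    and "\<And>s. s \<in> closed_segment 0 t \<Longrightarrow> norm (dir_deriv f v (p + s *s v) - c) \<le> B"
  shows "norm (f (p + t *s v) - f p - t * c) \<le> B * norm t"
proof -
  have "norm ((f (p + t *s v) - t * c) - (f (p + 0 *s v) - 0 * c)) \<le> B * norm (t - 0)"
  proof (rule field_differentiable_bound[of "closed_segment 0 t" _ "\<lambda>s. dir_deriv f v (p + s *s v) - c"])
    fix s assume s: "s \<in> closed_segment 0 t"
    show "((\<lambda>s. f (p + s *s v) - s * c) has_field_derivative dir_deriv f v (p + s *s v) - c)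
       (at s within closed_segment 0 t)"
      by (rule has_field_derivative_at_within)
        (auto intro!: derivative_eq_intros slice_DERIV[OF assms(1)] assms(2) s)
  qed (use assms(3) in auto)
  then show ?thesis by (simp add: algebra_simps)
qed

lemma small_slice:
  assumes "r > 0" shows "\<exists>\<rho>>0. \<forall>t. norm t \<le> \<rho> \<longrightarrow> norm (t *s (v :: complex^'m)) \<le> r"
proof (intro exI conjI allI impI)
  show "r / (norm v + 1) > 0" using assms by (simp add: add_nonneg_pos)
  fix t :: complex assume "norm t \<le> r / (norm v + 1)"
  then have "norm t * (norm v + 1) \<le> r" by (simp add: pos_le_divide_eq add_nonneg_pos)
  moreover have "norm t * norm v \<le> norm t * (norm v + 1)" by (simp add: algebra_simps)
  ultimately show "norm (t *s v) \<le> r" by (simp add: norm_smult_vec)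
qed

text \<open>
  Cauchy's inequality for the difference of two nearby slices bounds the difference of their
  derivatives by that of the values of \<open>f\<close> on two small circles, so uniform continuity of \<open>f\<close>
  passes to the derivative.
\<close>
lemma continuous_on_dir_deriv:
  fixes f :: "complex^'m \<Rightarrow> complex"
  assumes "open U" "continuous_on U f" and sl: "differentiable_along U v f"
  shows "continuous_on U (dir_deriv f v)"
proof (rule continuous_at_imp_continuous_on, intro ballI)
  fix p assume "p \<in> U"
  then obtain R where R: "R > 0" "cball p R \<subseteq> U"
    using \<open>open U\<close> open_contains_cball by blast
  obtain r where r: "r > 0" "\<And>t. norm t \<le> r \<Longrightarrow> norm (t *s v) \<le> R/2"
    using small_slice[of "R/2" v] R by auto
  have uc: "uniformly_continuous_on (cball p R) f"
    using assms(2) R(2) by (intro compact_uniformly_continuous) (auto intro: continuous_on_subset)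
  show "isCont (dir_deriv f v) p"
    unfolding continuous_at_eps_delta
  proof (intro allI impI)
    fix e :: real assume "e > 0"
    then obtain d where d: "d > 0"
      "\<And>x y. x \<in> cball p R \<Longrightarrow> y \<in> cball p R \<Longrightarrow> dist y x < d \<Longrightarrow> dist (f y) (f x) < e/2 * r"
      using uc r unfolding uniformly_continuous_on_def by (metis half_gt_zero mult_pos_pos)
    show "\<exists>d>0. \<forall>q. dist q p < d \<longrightarrow> dist (dir_deriv f v q) (dir_deriv f v p) < e"
    proof (intro exI conjI allI impI)
      show "min d (R/2) > 0" using d R by simp
      fix q assume q: "dist q p < min d (R/2)"
      have pin: "p + t *s v \<in> cball p R" if "norm t \<le> r" for t
        using r(2)[OF that] R by (simp add: dist_norm)
      have qin: "q + t *s v \<in> cball p R" if "norm t \<le> r" for t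
      proof -
        have "norm (q + t *s v - p) \<le> norm (q - p) + norm (t *s v)"
          by (metis add_diff_eq diff_add_eq norm_triangle_ineq)
        then show ?thesis using r(2)[OF that] q by (simp add: dist_norm norm_minus_commute)
      qed
      \<comment> \<open>The derivative of this difference at 0 is what must be small.\<close>
      define F where "F = (\<lambda>t. f (q + t *s v) - f (p + t *s v))"
      have hol: "F holomorphic_on cball 0 r"
        unfolding F_def using pin qin R
        by (intro holomorphic_intros slice_holomorphic[OF sl]) auto
      have "norm ((deriv ^^ 1) F 0) \<le> fact 1 * (e/2 * r) / r ^ 1"
      proof (rule Cauchy_inequality)
        show "F holomorphic_on ball 0 r" using hol by (rule holomorphic_on_subset) auto
        show "continuous_on (cball 0 r) F" using hol by (rule holomorphic_on_imp_continuous_on)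
        fix x :: complex assume x: "norm (0 - x) = r"
        have "dist (f (q + x *s v)) (f (p + x *s v)) < e/2 * r"
          using x q by (intro d pin qin) (auto simp: dist_norm)
        then show "norm (F x) \<le> e/2 * r" by (simp add: F_def dist_norm)
      qed (use r in auto)
      moreover have "deriv F 0 = dir_deriv f v q - dir_deriv f v p"
      proof (rule DERIV_imp_deriv)
        have "q \<in> U" using qin[of 0] r R(2) by auto
        then show "(F has_field_derivative dir_deriv f v q - dir_deriv f v p) (at 0)"
          unfolding F_def using slice_DERIV[OF sl, of q 0] slice_DERIV[OF sl, of p 0] \<open>p \<in> U\<close>
          by (intro DERIV_diff) auto
      qed
      ultimately show "dist (dir_deriv f v q) (dir_deriv f v p) < e"
        using r \<open>e > 0\<close> by (simp add: dist_norm)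
    qed
  qed
qed

text \<open>
  The partial derivatives are continuous, so the increment of \<open>f\<close> can be estimated one coordinate
  at a time by the mean value inequality.
\<close>
lemma osgood:
  fixes f :: "complex^'m \<Rightarrow> complex"
  assumes U: "open U" and cont: "continuous_on U f" and sl: "\<And>i. differentiable_along U (axis i 1) f"
  shows "hol_fun_on U f"
  unfolding hol_fun_on_def
proof (intro ballI exI conjI allI)
  fix p assume p: "p \<in> U"
  define c where "c = (\<lambda>i. dir_deriv f (axis i 1) p)"
  define D where "D = (\<lambda>h. \<Sum>i\<in>UNIV. h $ i * c i)"
  show "D (k *s v) = k * D v" for k v
    by (simp add: D_def sum_distrib_left mult.assoc)
  have "bounded_linear D"
    unfolding D_def
    by (intro bounded_linear_sum bounded_linear_mult_const) (rule bounded_linear_vec_nth)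
  moreover have "\<exists>d>0. \<forall>y. norm (y - p) < d \<longrightarrow> norm (f y - f p - D (y - p)) \<le> e * norm (y - p)"
    if "e > 0" for e
  proof -
    define e' where "e' = e / CARD('m)"
    have e': "e' > 0" using that by (simp add: e'_def)
    have "eventually (\<lambda>q. q \<in> U \<and> (\<forall>i. dist (dir_deriv f (axis i 1) q) (c i) < e')) (nhds p)"
    proof (intro eventually_conj eventually_all_finite)
      show "eventually (\<lambda>q. q \<in> U) (nhds p)" using U p by (simp add: eventually_nhds_in_open)
      fix i
      have "isCont (dir_deriv f (axis i 1)) p"
        using continuous_on_dir_deriv[OF U cont sl] U p continuous_on_eq_continuous_at by blast
      then show "eventually (\<lambda>q. dist (dir_deriv f (axis i 1) q) (c i) < e') (nhds p)"
        unfolding c_def isCont_def tendsto_at_iff_tendsto_nhds using e' by (rule tendstoD)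
    qed
    then obtain d where d: "d > 0"
      "\<And>q. dist q p < d \<Longrightarrow> q \<in> U \<and> (\<forall>i. dist (dir_deriv f (axis i 1) q) (c i) < e')"
      unfolding eventually_nhds_metric by blast
    show ?thesis
    proof (intro exI conjI allI impI)
      fix y assume y: "norm (y - p) < d"
      define h where "h = y - p"
      define hS where "hS = (\<lambda>S. \<chi> i. if i \<in> S then h $ i else 0)"
      have "norm (f (p + hS S) - f p - (\<Sum>i\<in>S. h $ i * c i)) \<le> card S * e' * norm h" for S
        using finite[of S]
      proof (induction S rule: finite_induct)
        case empty
        have "hS {} = 0" by (simp add: hS_def vec_eq_iff)
        then show ?case by simp
      next
        case (insert i S)
        have eq: "hS (insert i S) = hS S + h $ i *s axis i 1"
          using insert by (auto simp: hS_def vec_eq_iff axis_def)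
        have near: "dist (p + hS S + s *s axis i 1) p < d" if "s \<in> closed_segment 0 (h $ i)" for s
        proof -
          have "norm s \<le> norm (h $ i)" using that segment_bound[of s 0 "h $ i"] by auto
          then have "norm (hS S + s *s axis i 1) \<le> norm h"
            using insert by (intro norm_le_componentwise_cart) (auto simp: hS_def axis_def)
          then show ?thesis using y by (simp add: dist_norm h_def add.assoc)
        qed
        have "norm (f (p + hS S + h $ i *s axis i 1) - f (p + hS S) - h $ i * c i) \<le> e' * norm (h $ i)"
        proof (rule slice_increment[OF sl])
          fix s assume "s \<in> closed_segment 0 (h $ i)"
          note * = d(2)[OF near[OF this]]
          show "p + hS S + s *s axis i 1 \<in> U" using * by simp
          show "norm (dir_deriv f (axis i 1) (p + hS S + s *s axis i 1) - c i) \<le> e'"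
            using * by (auto simp: dist_norm less_imp_le)
        qed
        also have "\<dots> \<le> e' * norm h"
          using e' component_le_norm_cart Finite_Cartesian_Product.norm_nth_le
          by (intro mult_left_mono) auto
        finally have 1: "norm (f (p + hS (insert i S)) - f (p + hS S) - h $ i * c i) \<le> e' * norm h"
          by (simp add: eq add.assoc)
        have "f (p + hS (insert i S)) - f p - (\<Sum>i\<in>insert i S. h $ i * c i) =
           (f (p + hS (insert i S)) - f (p + hS S) - h $ i * c i) +
           (f (p + hS S) - f p - (\<Sum>i\<in>S. h $ i * c i))"
          using insert by simp
        also have "norm \<dots> \<le> e' * norm h + card S * e' * norm h"
          by (intro norm_triangle_mono 1 insert.IH)
        finally show ?case using insert by (simp add: algebra_simps)
      qed
      from this[of UNIV] have "norm (f (p + hS UNIV) - f p - D h) \<le> e * norm h"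
        by (simp add: D_def e'_def)
      moreover have "p + hS UNIV = y" by (simp add: hS_def h_def vec_eq_iff)
      ultimately show "norm (f y - f p - D (y - p)) \<le> e * norm (y - p)" by (simp add: h_def)
    qed (use d in auto)
  qed
  ultimately show "(f has_derivative D) (at p)"
    by (simp add: has_derivative_at_alt)
qed

section \<open>Holomorphic functions and their derivatives\<close>

lemma hol_fun_on_continuous_on: "hol_fun_on U f \<Longrightarrow> continuous_on U f"
  unfolding hol_fun_on_def
  by (metis continuous_at_imp_continuous_on has_derivative_continuous)

lemma hol_fun_on_subset: "hol_fun_on U f \<Longrightarrow> V \<subseteq> U \<Longrightarrow> hol_fun_on V f"
  unfolding hol_fun_on_def by blast

lemma slice_has_derivative: "((\<lambda>t. p + t *s (v :: complex^'m)) has_derivative (\<lambda>t. t *s v)) (at t0)"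
  using has_derivative_add[OF has_derivative_const[of p]
      bounded_linear_imp_has_derivative[OF bounded_linear_smult_left[of v]]]
  by simp

lemma has_derivative_imp_DERIV_slice:
  fixes f :: "complex^'m \<Rightarrow> complex"
  assumes "(f has_derivative D) (at p)" "\<forall>c v. D (c *s v) = c * D v"
  shows "((\<lambda>t. f (p + t *s v)) has_field_derivative D v) (at 0)"
proof -
  have "(f has_derivative D) (at (p + 0 *s v))" using assms by simp
  from has_derivative_compose[OF slice_has_derivative this]
  show ?thesis
    using assms(2) by (simp add: has_field_derivative_def mult.commute[of _ "D v"])
qed

lemma hol_fun_on_differentiable_along: "hol_fun_on U f \<Longrightarrow> differentiable_along U v f"
  unfolding hol_fun_on_def differentiable_along_def field_differentiable_def
  using has_derivative_imp_DERIV_slice by blast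

lemma hol_fun_on_has_derivative:
  assumes "hol_fun_on U f" "p \<in> U"
  shows "(f has_derivative (\<lambda>v. dir_deriv f v p)) (at p)" "dir_deriv f (c *s v) p = c * dir_deriv f v p"
    "linear (\<lambda>v. dir_deriv f v p)"
proof -
  obtain D where D: "(f has_derivative D) (at p)" "\<forall>c v. D (c *s v) = c * D v"
    using assms unfolding hol_fun_on_def by blast
  have eq: "dir_deriv f v p = D v" for v
    unfolding dir_deriv_def using has_derivative_imp_DERIV_slice[OF D] by (rule DERIV_imp_deriv)
  show "(f has_derivative (\<lambda>v. dir_deriv f v p)) (at p)" "dir_deriv f (c *s v) p = c * dir_deriv f v p"
    "linear (\<lambda>v. dir_deriv f v p)"
    using D by (simp_all add: eq has_derivative_linear)
qed

lemma dir_deriv_eqI: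
  fixes f :: "complex^'m \<Rightarrow> complex"
  assumes "(f has_derivative D) (at p)" "\<forall>c v. D (c *s v) = c * D v"
  shows "dir_deriv f v p = D v"
  unfolding dir_deriv_def using has_derivative_imp_DERIV_slice[OF assms] by (rule DERIV_imp_deriv)

lemma dir_deriv_sum:
  fixes f :: "complex^'m \<Rightarrow> complex"
  assumes "hol_fun_on U f" "p \<in> U"
  shows "dir_deriv f v p = (\<Sum>i\<in>UNIV. v $ i * dir_deriv f (axis i 1) p)"
proof -
  interpret linear "\<lambda>v. dir_deriv f v p" by (rule hol_fun_on_has_derivative[OF assms])
  have "dir_deriv f v p = dir_deriv f (\<Sum>i\<in>UNIV. v $ i *s axis i 1) p"
    by (simp add: basis_expansion)
  also have "\<dots> = (\<Sum>i\<in>UNIV. v $ i * dir_deriv f (axis i 1) p)"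
    by (simp add: sum hol_fun_on_has_derivative(2)[OF assms])
  finally show ?thesis .
qed

lemma hol_fun_on_const: "hol_fun_on U (\<lambda>_. c)"
  unfolding hol_fun_on_def by (auto intro!: exI[of _ "\<lambda>_. 0"])

lemma hol_fun_on_nth: "hol_fun_on U (\<lambda>p. p $ i)"
  unfolding hol_fun_on_def
  by (auto intro!: exI[of _ "\<lambda>p. p $ i"] bounded_linear_imp_has_derivative bounded_linear_vec_nth)

lemma hol_fun_on_add:
  assumes "hol_fun_on U f" "hol_fun_on U g"
  shows "hol_fun_on U (\<lambda>p. f p + g p)"
  unfolding hol_fun_on_def
proof
  fix p assume p: "p \<in> U"
  show "\<exists>D. ((\<lambda>p. f p + g p) has_derivative D) (at p) \<and> (\<forall>c v. D (c *s v) = c * D v)"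
    using has_derivative_add[OF hol_fun_on_has_derivative(1)[OF assms(1) p] hol_fun_on_has_derivative(1)[OF assms(2) p]]
    by (auto intro!: exI simp: hol_fun_on_has_derivative(2)[OF assms(1) p] 
        hol_fun_on_has_derivative(2)[OF assms(2) p] algebra_simps)
qed

lemma hol_fun_on_compose_entire:
  assumes "hol_fun_on U f" "\<And>p. p \<in> U \<Longrightarrow> g field_differentiable at (f p)"
  shows "hol_fun_on U (\<lambda>p. g (f p))"
  unfolding hol_fun_on_def
proof
  fix p assume p: "p \<in> U"
  then obtain g' where g': "(g has_derivative (*) g') (at (f p))"
    using assms(2) by (auto simp: field_differentiable_def has_field_derivative_def)
  show "\<exists>D. ((\<lambda>p. g (f p)) has_derivative D) (at p) \<and> (\<forall>c v. D (c *s v) = c * D v)"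
    using has_derivative_compose[OF hol_fun_on_has_derivative(1)[OF assms(1) p] g']
    by (auto intro!: exI simp: hol_fun_on_has_derivative(2)[OF assms(1) p])
qed

lemma hol_fun_on_mult: 
  assumes "hol_fun_on U f" "hol_fun_on U g"
  shows "hol_fun_on U (\<lambda>p. f p * g p)"
  unfolding hol_fun_on_def
proof
  fix p assume p: "p \<in> U"
  show "\<exists>D. ((\<lambda>p. f p * g p) has_derivative D) (at p) \<and> (\<forall>c v. D (c *s v) = c * D v)"
    using has_derivative_mult[OF hol_fun_on_has_derivative(1)[OF assms(1) p] hol_fun_on_has_derivative(1)[OF assms(2) p]]
    by (auto intro!: exI simp: hol_fun_on_has_derivative(2)[OF assms(1) p] 
        hol_fun_on_has_derivative(2)[OF assms(2) p] algebra_simps)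
qed

lemma hol_fun_on_uminus: "hol_fun_on U f \<Longrightarrow> hol_fun_on U (\<lambda>p. - f p)"
  using hol_fun_on_mult[OF hol_fun_on_const[of U "-1"]] by simp

lemma hol_fun_on_diff: "hol_fun_on U f \<Longrightarrow> hol_fun_on U g \<Longrightarrow> hol_fun_on U (\<lambda>p. f p - g p)"
  using hol_fun_on_add[OF _ hol_fun_on_uminus] by simp

lemma hol_fun_on_power: "hol_fun_on U f \<Longrightarrow> hol_fun_on U (\<lambda>p. f p ^ k)"
  by (induction k) (auto intro: hol_fun_on_const hol_fun_on_mult)

lemma hol_fun_on_divide:
  "hol_fun_on U f \<Longrightarrow> hol_fun_on U g \<Longrightarrow> (\<And>p. p \<in> U \<Longrightarrow> g p \<noteq> 0) \<Longrightarrow> hol_fun_on U (\<lambda>p. f p / g p)"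
  unfolding divide_inverse
  by (intro hol_fun_on_mult hol_fun_on_compose_entire[where g = inverse])
     (auto intro!: field_differentiable_inverse field_differentiable_ident)

lemmas hol_fun_intros = hol_fun_on_const hol_fun_on_nth hol_fun_on_add hol_fun_on_mult hol_fun_on_uminus
  hol_fun_on_diff hol_fun_on_power hol_fun_on_divide

lemma hol_map_on_has_derivative:
  fixes F :: "complex^'m \<Rightarrow> complex^'k"
  assumes "hol_map_on U F" "p \<in> U"
  shows "(F has_derivative (\<lambda>v. \<chi> i. dir_deriv (\<lambda>q. F q $ i) v p)) (at p)"
  using assms unfolding hol_map_on_def
  by (intro has_derivative_componentwise_within[THEN iffD2]) 
     (auto simp: Basis_vec_def inner_axis intro!: has_derivative_inner_left hol_fun_on_has_derivative(1))

lemma hol_map_on_continuous_on: "hol_map_on U F \<Longrightarrow> continuous_on U F"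
  by (meson continuous_at_imp_continuous_on has_derivative_continuous hol_map_on_has_derivative)

lemma hol_fun_on_compose:
  fixes F :: "complex^'m \<Rightarrow> complex^'k"
  assumes "hol_map_on U F" "hol_fun_on V f" "F ` U \<subseteq> V"
  shows "hol_fun_on U (\<lambda>p. f (F p))"
  unfolding hol_fun_on_def
proof
  fix p assume p: "p \<in> U"
  then have *: "F p \<in> V" using assms by auto
  have lin: "dir_deriv (\<lambda>q. F q $ i) (c *s v) p = c * dir_deriv (\<lambda>q. F q $ i) v p" for i c v
    using assms(1) p unfolding hol_map_on_def by (intro hol_fun_on_has_derivative) auto
  have "(\<chi> i. dir_deriv (\<lambda>q. F q $ i) (c *s v) p) = c *s (\<chi> i. dir_deriv (\<lambda>q. F q $ i) v p)" for c v
    by (simp add: vec_eq_iff lin)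
  then show "\<exists>D. ((\<lambda>p. f (F p)) has_derivative D) (at p) \<and> (\<forall>c v. D (c *s v) = c * D v)"
    using has_derivative_compose[OF hol_map_on_has_derivative[OF assms(1) p] hol_fun_on_has_derivative(1)[OF assms(2) *]]
    by (auto intro!: exI simp: hol_fun_on_has_derivative(2)[OF assms(2) *])
qed

lemma hol_map_on_compose:
  assumes "hol_map_on U F" "hol_map_on V G" "F ` U \<subseteq> V"
  shows "hol_map_on U (\<lambda>p. G (F p))"
  using assms hol_fun_on_compose unfolding hol_map_on_def by blast

lemma hol_fun_on_cong:
  assumes "open U" "hol_fun_on U f" "\<And>p. p \<in> U \<Longrightarrow> f p = g p"
  shows "hol_fun_on U g"
  using assms unfolding hol_fun_on_def by (metis has_derivative_transform_within_open)

text \<open>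
  By Osgood's lemma only slices of the derivative need to be holomorphic. On such a slice the
  derivative is the uniform limit of difference quotients of \<open>f\<close>, which are holomorphic there.
\<close>
lemma hol_fun_on_dir_deriv:
  fixes f :: "complex^'m \<Rightarrow> complex"
  assumes U: "open U" and f: "hol_fun_on U f"
  shows "hol_fun_on U (dir_deriv f v)"
proof (rule osgood[OF U])
  note sl = hol_fun_on_differentiable_along[OF f]
  show cont: "continuous_on U (dir_deriv f v)"
    by (intro continuous_on_dir_deriv U hol_fun_on_continuous_on[OF f] sl)
  have "(\<lambda>t. dir_deriv f v (p + t *s w)) field_differentiable at 0" if "p \<in> U" for p w
  proof -
    obtain R where R: "R > 0" "cball p R \<subseteq> U"
      using U \<open>p \<in> U\<close> open_contains_cball by blast
    obtain r where r: "r > 0" "\<And>t. norm t \<le> r \<Longrightarrow> norm (t *s w) \<le> R/2"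
      using small_slice[of "R/2" w] R by auto
    obtain r' where r': "r' > 0" "\<And>t. norm t \<le> r' \<Longrightarrow> norm (t *s v) \<le> R/2"
      using small_slice[of "R/2" v] R by auto
    have inK: "p + t *s w + s *s v \<in> cball p R" if "norm t \<le> r" "norm s \<le> r'" for t s
    proof -
      have "norm (t *s w + s *s v) \<le> R/2 + R/2"
        by (intro norm_triangle_mono r r' that)
      then have "norm (p - (p + t *s w + s *s v)) \<le> R"
        using norm_minus_cancel[of "t *s w + s *s v"] by (simp add: add.assoc)
      then show ?thesis by (simp add: dist_norm)
    qed
    have inK0: "p + t *s w \<in> cball p R" if "norm t \<le> r" for t
      using inK[OF that, of 0] r' by simp
    have "uniformly_continuous_on (cball p R) (dir_deriv f v)"
      using cont R(2) by (intro compact_uniformly_continuous) (auto intro: continuous_on_subset)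
    note uc = this[unfolded uniformly_continuous_on_def, rule_format]
    have "uniform_limit (cball 0 r) (\<lambda>h t. (f (p + t *s w + h *s v) - f (p + t *s w)) / h)
      (\<lambda>t. dir_deriv f v (p + t *s w)) (at 0)"
      unfolding uniform_limit_iff
    proof (intro allI impI)
      fix e :: real assume "e > 0"
      obtain d where d: "d > 0" "\<And>x y. x \<in> cball p R \<Longrightarrow> y \<in> cball p R \<Longrightarrow> dist y x < d \<Longrightarrow>
          dist (dir_deriv f v y) (dir_deriv f v x) < e/2"
        using uc[of "e/2"] \<open>e > 0\<close> by (meson half_gt_zero)
      obtain r'' where r'': "r'' > 0" "\<And>t. norm t \<le> r'' \<Longrightarrow> norm (t *s v) \<le> d/2"
        using small_slice[of "d/2" v] d by auto
      have "dist ((f (p + t *s w + h *s v) - f (p + t *s w)) / h) (dir_deriv f v (p + t *s w)) < e"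
        if t: "norm t \<le> r" and h: "h \<noteq> 0" "norm h < min r' r''" for t h
      proof -
        have "norm (f (p + t *s w + h *s v) - f (p + t *s w) - h * dir_deriv f v (p + t *s w)) \<le> e/2 * norm h"
        proof (rule slice_increment[OF sl])
          fix s assume s: "s \<in> closed_segment 0 h"
          then have "norm s \<le> norm h" using segment_bound[of s 0 h] by auto
          then have s': "norm s \<le> r'" "norm s \<le> r''" using h by auto
          show "p + t *s w + s *s v \<in> U" using inK[OF t s'(1)] R by auto
          have "dist (dir_deriv f v (p + t *s w + s *s v)) (dir_deriv f v (p + t *s w)) < e/2"
            using r''(2)[OF s'(2)] d(1) by (intro d inK inK0 t s') (auto simp: dist_norm)
          then show "norm (dir_deriv f v (p + t *s w + s *s v) - dir_deriv f v (p + t *s w)) \<le> e/2"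
            by (simp add: dist_norm)
        qed
        then have "norm ((f (p + t *s w + h *s v) - f (p + t *s w)) / h - dir_deriv f v (p + t *s w)) \<le> e/2"
          using h by (simp add: field_simps norm_divide flip: norm_mult)
        then show ?thesis using \<open>e > 0\<close> by (simp add: dist_norm)
      qed
      then show "\<forall>\<^sub>F h in at 0. \<forall>t\<in>cball 0 r.
          dist ((f (p + t *s w + h *s v) - f (p + t *s w)) / h) (dir_deriv f v (p + t *s w)) < e"
        unfolding eventually_at using r' r'' by (intro exI[of _ "min r' r''"]) auto
    qed
    moreover have "\<forall>\<^sub>F h in at (0::complex). 
       continuous_on (cball 0 r) (\<lambda>t. (f (p + t *s w + h *s v) - f (p + t *s w)) / h) \<and>
       (\<lambda>t. (f (p + t *s w + h *s v) - f (p + t *s w)) / h) holomorphic_on ball 0 r"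
      unfolding eventually_at
    proof (intro exI[of _ r'] conjI r' ballI impI)
      fix h :: complex assume h: "h \<noteq> 0 \<and> dist h 0 < r'"
      have "(\<lambda>t. f (p + h *s v + t *s w)) holomorphic_on cball 0 r"
      proof (rule slice_holomorphic[OF sl])
        fix t :: complex assume "t \<in> cball 0 r"
        then show "p + h *s v + t *s w \<in> U" using h inK[of t h] R(2)
          by (auto simp: algebra_simps)
      qed
      then have "(\<lambda>t. f (p + t *s w + h *s v)) holomorphic_on cball 0 r"
        by (simp add: algebra_simps)
      moreover have "(\<lambda>t. f (p + t *s w)) holomorphic_on cball 0 r"
        using inK0 R(2) by (intro slice_holomorphic[OF sl]) auto
      ultimately have "(\<lambda>t. (f (p + t *s w + h *s v) - f (p + t *s w)) / h) holomorphic_on cball 0 r"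
        using h by (intro holomorphic_intros) auto
      then show "continuous_on (cball 0 r) (\<lambda>t. (f (p + t *s w + h *s v) - f (p + t *s w)) / h)"
        "(\<lambda>t. (f (p + t *s w + h *s v) - f (p + t *s w)) / h) holomorphic_on ball 0 r"
        by (auto intro: holomorphic_on_imp_continuous_on holomorphic_on_subset)
    qed
    ultimately have "(\<lambda>t. dir_deriv f v (p + t *s w)) holomorphic_on ball 0 r"
      by - (rule holomorphic_uniform_limit[where F = "at (0::complex)"], assumption+, auto)
    then show ?thesis using r by (auto simp: holomorphic_on_open field_differentiable_def)
  qed
  then show "differentiable_along U (axis i 1) (dir_deriv f v)" for i by (simp add: differentiable_along_def)
qed

section \<open>Difference quotients and interpolation\<close>

definition diff_quotient :: "(complex^'n \<Rightarrow> complex) \<Rightarrow> complex^'n \<Rightarrow> complex^'n \<Rightarrow> complex \<Rightarrow> complex" where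
  "diff_quotient f v z t = (if t = 0 then dir_deriv f v z else (f (z + t *s v) - f z) / t)"

lemma hol_map_on_continuous_at:
  "hol_map_on U F \<Longrightarrow> p \<in> U \<Longrightarrow> isCont F p"
  using has_derivative_continuous hol_map_on_has_derivative by blast

text \<open>
  Joint holomorphy in the base point and the increment, with the increment stored in the coordinate
  \<open>None\<close>. The critical points are those with increment 0. There a slice in a direction of the base
  point is a slice of the derivative of \<open>f\<close>, and a slice in the direction of the increment has a
  removable singularity; continuity is the mean value inequality.
\<close>
lemma hol_fun_on_diff_quotient_coordinates:
  fixes f :: "complex^'n \<Rightarrow> complex"
  assumes f: "hol_fun_on UNIV f"
  shows "hol_fun_on UNIV (\<lambda>p. diff_quotient f v (\<chi> i. p $ Some i) (p $ None))"
proof -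
  define Z :: "complex^('n option) \<Rightarrow> complex^'n" where "Z = (\<lambda>p. \<chi> i. p $ Some i)"
  define q where "q = (\<lambda>p. diff_quotient f v (Z p) (p $ None))"
  have Z: "hol_map_on UNIV Z" unfolding hol_map_on_def Z_def by (simp add: hol_fun_on_nth)
  have Zv: "hol_map_on UNIV (\<lambda>p. Z p + p $ None *s v)"
    using Z unfolding hol_map_on_def by (auto intro!: hol_fun_intros)
  note sl = hol_fun_on_differentiable_along[OF f]
  have op: "open {p :: complex^('n option). p $ None \<noteq> 0}"
    by (intro open_Collect_neq continuous_intros)
  have "hol_fun_on {p. p $ None \<noteq> 0} (\<lambda>p. (f (Z p + p $ None *s v) - f (Z p)) / p $ None)"
    using hol_fun_on_compose[OF Z f] hol_fun_on_compose[OF Zv f]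
    by (intro hol_fun_intros) (auto intro: hol_fun_on_subset)
  then have q: "hol_fun_on {p. p $ None \<noteq> 0} q"
    by (rule hol_fun_on_cong[OF op]) (auto simp: q_def diff_quotient_def)
  have cont0: "isCont q p" if p: "p $ None = 0" for p
    unfolding isCont_def tendsto_at_iff_tendsto_nhds
  proof (rule tendstoI)
    fix e :: real assume e: "e > 0"
    have "isCont (dir_deriv f v) (Z p)"
      using hol_fun_on_continuous_on[OF hol_fun_on_dir_deriv[OF open_UNIV f]]
      by (simp add: continuous_on_eq_continuous_at)
    then obtain d where d: "d > 0" "\<And>z. dist z (Z p) < d \<Longrightarrow> dist (dir_deriv f v z) (dir_deriv f v (Z p)) < e/2"
      unfolding continuous_at_eps_delta using e by (meson half_gt_zero)
    have "isCont Z p" "isCont (\<lambda>p. p $ None *s v) p"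
      using hol_map_on_continuous_at[OF Z, of p]
      by (auto simp: vec_eq_iff intro!: bounded_linear.isCont[OF bounded_linear_smult_left] continuous_intros)
    then have "(Z \<longlongrightarrow> Z p) (nhds p)" "((\<lambda>p. p $ None *s v) \<longlongrightarrow> p $ None *s v) (nhds p)"
      unfolding isCont_def tendsto_at_iff_tendsto_nhds[of Z]
        tendsto_at_iff_tendsto_nhds[of "\<lambda>p. p $ None *s v"] .
    then have "(Z \<longlongrightarrow> Z p) (nhds p)" "((\<lambda>p. p $ None *s v) \<longlongrightarrow> 0) (nhds p)"
      using p by simp_all
    then have "\<forall>\<^sub>F x in nhds p. dist (Z x) (Z p) < d/2 \<and> dist (x $ None *s v) 0 < d/2"
      using d by (intro eventually_conj tendstoD) auto
    then show "\<forall>\<^sub>F x in nhds p. dist (q x) (q p) < e"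
    proof eventually_elim
      case (elim x)
      show ?case
      proof (cases "x $ None = 0")
        case True
        have "dist (Z x) (Z p) < d" using elim d(1) by linarith
        from d(2)[OF this] have "dist (dir_deriv f v (Z x)) (dir_deriv f v (Z p)) < e" using e by linarith
        then show ?thesis using p True by (simp add: q_def diff_quotient_def)
      next
        case False
        have "norm (f (Z x + x $ None *s v) - f (Z x) - x $ None * dir_deriv f v (Z p)) \<le> e/2 * norm (x $ None)"
        proof (rule slice_increment[OF sl])
          fix s assume "s \<in> closed_segment 0 (x $ None)"
          then have "norm s \<le> norm (x $ None)" using segment_bound[of s 0 "x $ None"] by auto
          then have "norm (s *s v) \<le> norm (x $ None *s v)"
            by (simp add: norm_smult_vec mult_right_mono)
          then have "norm (s *s v) < d/2" using elim by simp
          moreover have "norm (Z x - Z p) < d/2" using elim by (simp add: dist_norm)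
          ultimately have "norm ((Z x - Z p) + s *s v) < d" using norm_triangle_lt[of "Z x - Z p" "s *s v" d] by simp
          then have "dist (Z x + s *s v) (Z p) < d" by (simp add: dist_norm algebra_simps)
          from d(2)[OF this] show "norm (dir_deriv f v (Z x + s *s v) - dir_deriv f v (Z p)) \<le> e/2"
            by (simp add: dist_norm)
        qed auto
        then have "norm ((f (Z x + x $ None *s v) - f (Z x)) / x $ None - dir_deriv f v (Z p)) \<le> e/2"
          using False by (simp add: field_simps norm_divide flip: norm_mult)
        then show ?thesis using p e False by (simp add: q_def diff_quotient_def dist_norm)
      qed
    qed
  qed
  have "hol_fun_on UNIV q"
  proof (rule osgood)
    have "isCont q p" for p
      using cont0 hol_fun_on_continuous_on[OF q] op continuous_on_eq_continuous_at by (cases "p $ None = 0") auto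
    then show "continuous_on UNIV q" by (simp add: continuous_on_eq_continuous_at)
    fix i
    show "differentiable_along UNIV (axis i 1) q"
      unfolding differentiable_along_def
    proof (intro ballI)
      fix p :: "complex^('n option)"
      show "(\<lambda>t. q (p + t *s axis i 1)) field_differentiable at 0"
      proof (cases "p $ None = 0")
        case False
        then show ?thesis using hol_fun_on_differentiable_along[OF q] by (simp add: differentiable_along_def)
      next
        case p: True
        show ?thesis
        proof (cases i)
          case None
          have "(\<lambda>t. f (Z p + t *s v)) holomorphic_on UNIV"
            by (rule slice_holomorphic[OF sl]) auto
          then have "(\<lambda>t. if t = 0 then deriv (\<lambda>t. f (Z p + t *s v)) 0 
             else (f (Z p + t *s v) - f (Z p + 0 *s v)) / (t - 0)) holomorphic_on UNIV"
            by (intro pole_lemma) auto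
          moreover have "(\<lambda>t. if t = 0 then deriv (\<lambda>t. f (Z p + t *s v)) 0 
             else (f (Z p + t *s v) - f (Z p + 0 *s v)) / (t - 0)) = (\<lambda>t. q (p + t *s axis i 1))"
          proof
            fix t
            have "Z (p + t *s axis i 1) = Z p" by (simp add: Z_def None axis_def vec_eq_iff)
            then show "(if t = 0 then deriv (\<lambda>t. f (Z p + t *s v)) 0 
             else (f (Z p + t *s v) - f (Z p + 0 *s v)) / (t - 0)) = q (p + t *s axis i 1)"
              using p by (simp add: q_def diff_quotient_def dir_deriv_def None)
          qed
          ultimately show ?thesis by (auto simp: holomorphic_on_open field_differentiable_def)
        next
          case (Some j)
          have "Z (p + t *s axis i 1) = Z p + t *s axis j 1" for t
            by (simp add: Z_def Some axis_def vec_eq_iff)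
          then have "(\<lambda>t. q (p + t *s axis i 1)) = (\<lambda>t. dir_deriv f v (Z p + t *s axis j 1))"
            using p by (simp add: q_def diff_quotient_def Some axis_def)
          then show ?thesis
            using hol_fun_on_differentiable_along[OF hol_fun_on_dir_deriv[OF open_UNIV f]] by (simp add: differentiable_along_def)
        qed
      qed
    qed
  qed auto
  then show ?thesis by (simp add: q_def Z_def)
qed

lemma hol_fun_on_diff_quotient:
  fixes f :: "complex^'n \<Rightarrow> complex"
  assumes f: "hol_fun_on UNIV f" and "hol_map_on U Z" "hol_fun_on U T"
  shows "hol_fun_on U (\<lambda>p. diff_quotient f v (Z p) (T p))"
proof -
  define F where "F = (\<lambda>p. \<chi> i. case i of None \<Rightarrow> T p | Some i \<Rightarrow> Z p $ i)"
  have "hol_map_on U F"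
    unfolding hol_map_on_def
  proof
    fix i show "hol_fun_on U (\<lambda>p. F p $ i)"
      using assms(2,3) by (cases i) (simp_all add: hol_map_on_def F_def)
  qed
  from hol_fun_on_compose[OF this hol_fun_on_diff_quotient_coordinates[OF f, of v]]
  show ?thesis by (simp add: F_def vec_nth_inverse)
qed

text \<open>
  Interpolate at one more number at a time. The correction at stage \<open>k\<close> contains the factor
  \<open>(z / k)^m\<close>, which is 1 at the new node; with \<open>m\<close> large the correction is below \<open>2^{-k}\<close> on
  the disc of radius \<open>k / 2\<close>, so that the interpolants converge locally uniformly.
\<close>
lemma entire_interpolation_nat:
  fixes c :: "nat \<Rightarrow> complex"
  shows "\<exists>g. g holomorphic_on UNIV \<and> (\<forall>n. g (of_nat n) = c n)"
proof -
  define P :: "nat \<Rightarrow> (complex \<Rightarrow> complex) \<Rightarrow> bool" where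
    "P = (\<lambda>k g. g holomorphic_on UNIV \<and> (\<forall>j<k. g (of_nat j) = c j))"
  define Q :: "nat \<Rightarrow> (complex \<Rightarrow> complex) \<Rightarrow> (complex \<Rightarrow> complex) \<Rightarrow> bool" where
    "Q = (\<lambda>k g g'. (\<forall>j<k. g' (of_nat j) = g (of_nat j)) \<and>
             (k > 0 \<longrightarrow> (\<forall>z\<in>cball 0 (k/2). norm (g' z - g z) \<le> (1/2)^k)))"
  have "\<exists>g. \<forall>n. P n (g n) \<and> Q n (g n) (g (Suc n))"
  proof (rule dependent_nat_choice)
    show "\<exists>g. P 0 g" by (auto simp: P_def intro!: exI[of _ "\<lambda>_. 0"])
    fix g k assume g: "P k g"
    define w where "w = (\<lambda>z::complex. \<Prod>i<k. z - of_nat i)"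
    define d where "d = c k - g (of_nat k)"
    have w0: "w (of_nat k) \<noteq> 0" "\<And>j. j < k \<Longrightarrow> w (of_nat j) = 0"
      by (auto simp: w_def)
    have hw: "w holomorphic_on UNIV" unfolding w_def by (intro holomorphic_intros)
    have "continuous_on (cball 0 (k/2)) (\<lambda>z. d * w z / w (of_nat k))"
      using hw w0 by (intro continuous_intros holomorphic_on_imp_continuous_on) (auto intro: holomorphic_on_subset)
    from compact_imp_bounded[OF compact_continuous_image[OF this]]
    obtain M where M: "M > 0" "\<And>z. z \<in> cball 0 (k/2) \<Longrightarrow> norm (d * w z / w (of_nat k)) \<le> M"
      by (auto simp: bounded_pos)
    obtain m where m: "(1/2 :: real) ^ m < (1/2)^k / M"
      using real_arch_pow_inv[of "(1/2)^k / M" "1/2"] M by auto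
    \<comment> \<open>The case distinction keeps the value at the node 0, where \<open>z / 0\<close> would be 0.\<close>
    define u where "u = (\<lambda>z. d * w z / w (of_nat k) * (if k = 0 then 1 else (z / of_nat k) ^ m))"
    have u: "u (of_nat k) = d" "\<And>j. j < k \<Longrightarrow> u (of_nat j) = 0"
      using w0 by (auto simp: u_def)
    have "norm (u z) \<le> (1/2)^k" if "k > 0" "z \<in> cball 0 (k/2)" for z
    proof -
      have "norm z / k \<le> 1/2" using that by (simp add: field_simps)
      then have "norm ((z / of_nat k) ^ m) \<le> (1/2)^m"
        by (simp add: norm_power norm_divide power_mono flip: power_divide)
      then have "norm (u z) \<le> M * (1/2)^m"
        using that M unfolding u_def norm_mult by (intro mult_mono) auto
      also have "\<dots> \<le> (1/2)^k" using m M by (simp add: field_simps)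
      finally show ?thesis .
    qed
    moreover have "u holomorphic_on UNIV"
      unfolding u_def using w0 hw by (cases "k = 0") (auto intro!: holomorphic_intros)
    ultimately have "P (Suc k) (\<lambda>z. g z + u z) \<and> Q k g (\<lambda>z. g z + u z)"
      using g u by (auto simp: P_def Q_def d_def less_Suc_eq intro!: holomorphic_intros)
    then show "\<exists>g'. P (Suc k) g' \<and> Q k g g'" by blast
  qed
  then obtain g where g: "\<And>k. g k holomorphic_on UNIV" "\<And>j k. j < k \<Longrightarrow> g k (of_nat j) = c j"
    "\<And>k z. k > 0 \<Longrightarrow> z \<in> cball 0 (k/2) \<Longrightarrow> norm (g (Suc k) z - g k z) \<le> (1/2)^k"
    unfolding P_def Q_def by metis
  define G where "G = (\<lambda>z. g 0 z + (\<Sum>k. g (Suc k) z - g k z))"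
  have ul: "uniform_limit (cball 0 r) g G sequentially" for r
  proof -
    have "uniform_limit (cball 0 r) (\<lambda>n z. \<Sum>i<n. g (Suc i) z - g i z) (\<lambda>z. \<Sum>k. g (Suc k) z - g k z) sequentially"
    proof (rule Weierstrass_m_test_ev)
      obtain N :: nat where N: "N > max 0 (2 * r)" using reals_Archimedean2 by blast
      show "\<forall>\<^sub>F n in sequentially. \<forall>z\<in>cball 0 r. norm (g (Suc n) z - g n z) \<le> (1/2)^n"
        unfolding eventually_sequentially using N by (intro exI[of _ N] allI impI ballI g(3)) auto
    qed (simp add: summable_geometric)
    from uniform_limit_add[OF uniform_limit_const this, of "g 0"]
    have "uniform_limit (cball 0 r) (\<lambda>n z. g 0 z + (\<Sum>i<n. g (Suc i) z - g i z)) G sequentially"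
      by (simp only: G_def)
    moreover have "g 0 z + (\<Sum>i<n. g (Suc i) z - g i z) = g n z" for n z
      using sum_lessThan_telescope[of "\<lambda>i. g i z" n] by simp
    ultimately show ?thesis by simp
  qed
  have "G holomorphic_on UNIV"
  proof (rule holomorphic_uniform_sequence[of _ g])
    show "\<exists>d>0. cball x d \<subseteq> UNIV \<and> uniform_limit (cball x d) g G sequentially" for x
      by (intro exI[of _ 1] conjI uniform_limit_on_subset[OF ul[of "norm x + 1"]])
        (simp_all add: cball_subset_cball_iff)
  qed (use g in auto)
  moreover have "G (of_nat j) = c j" for j
  proof (rule tendsto_unique)
    show "(\<lambda>n. g n (of_nat j)) \<longlonglongrightarrow> G (of_nat j)"
      using tendsto_uniform_limitI[OF ul[of j]] by simp
    show "(\<lambda>n. g n (of_nat j)) \<longlonglongrightarrow> c j"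
      by (rule tendsto_eventually) (auto simp: eventually_sequentially intro!: exI[of _ "Suc j"] g)
  qed simp
  ultimately show ?thesis by blast
qed

section \<open>Zeros under perturbation\<close>

text \<open>
  The maximum principle for \<open>t / F t\<close>. The bound is uniform in \<open>F\<close>: a simple zero that is the
  only one in the disc cannot become multiple in a limit whose values on the circle stay away from 0.
\<close>
lemma deriv_at_unique_zero_ge:
  fixes F :: "complex \<Rightarrow> complex"
  assumes F: "F holomorphic_on S" "open S" "cball 0 r \<subseteq> S" and r: "r > 0"
    and zero: "\<And>t. norm t \<le> r \<Longrightarrow> F t = 0 \<longleftrightarrow> t = 0"
    and simple: "deriv F 0 \<noteq> 0"
    and lower: "\<And>t. norm t = r \<Longrightarrow> norm (F t) \<ge> \<delta>"
    and \<delta>: "\<delta> > 0"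
  shows "norm (deriv F 0) \<ge> \<delta> / r"
proof -
  define h where "h = (\<lambda>z. if z = 0 then deriv F 0 else (F z - F 0) / (z - 0))"
  have "0 \<in> interior S" using F r by (metis centre_in_cball interior_open less_imp_le subsetD)
  then have h: "h holomorphic_on S" unfolding h_def using F by (intro pole_lemma) auto
  have F0: "F 0 = 0" using zero[of 0] r by simp
  have nz: "h z \<noteq> 0" if "norm z \<le> r" for z
    using zero[OF that] simple F0 by (auto simp: h_def)
  have inv: "(\<lambda>z. 1 / h z) holomorphic_on cball 0 r"
    using F(3) nz by (intro holomorphic_intros holomorphic_on_subset[OF h]) auto
  have "norm (1 / h 0) \<le> r / \<delta>"
  proof (rule maximum_modulus_frontier[of "\<lambda>z. 1 / h z" "cball 0 r"])
    show "(\<lambda>z. 1 / h z) holomorphic_on interior (cball 0 r)"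
      using inv by (rule holomorphic_on_subset) (rule interior_subset)
    show "continuous_on (closure (cball 0 r)) (\<lambda>z. 1 / h z)"
      using inv by (simp add: holomorphic_on_imp_continuous_on)
    fix z :: complex assume "z \<in> frontier (cball 0 r)"
    then have z: "norm z = r" using r by (auto simp: frontier_def)
    then show "norm (1 / h z) \<le> r / \<delta>"
      using lower[OF z] r \<delta> F0 by (auto simp: h_def norm_divide intro!: divide_left_mono mult_pos_pos)
  qed (use r in auto)
  moreover have "h 0 = deriv F 0" by (simp add: h_def)
  ultimately show ?thesis using simple \<delta> r by (simp add: norm_divide field_simps)
qed

section \<open>Differentials and tangent vectors\<close>

definition jac :: "(complex^'m \<Rightarrow> complex^'k) \<Rightarrow> complex^'m \<Rightarrow> complex^'m \<Rightarrow> complex^'k" where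
  "jac F v p = (\<chi> i. dir_deriv (\<lambda>q. F q $ i) v p)"

lemma jac_has_derivative:
  "hol_map_on U F \<Longrightarrow> p \<in> U \<Longrightarrow> (F has_derivative (\<lambda>v. jac F v p)) (at p)"
  unfolding jac_def by (rule hol_map_on_has_derivative)

lemma jac_scale:
  fixes F :: "complex^'m \<Rightarrow> complex^'k"
  assumes "hol_map_on U F" "p \<in> U"
  shows "jac F (c *s v) p = c *s jac F v p"
  using assms unfolding jac_def hol_map_on_def by (auto simp: vec_eq_iff hol_fun_on_has_derivative(2)[of U])

lemma dir_deriv_compose:
  fixes F :: "complex^'m \<Rightarrow> complex^'k"
  assumes "hol_map_on U F" "p \<in> U" "hol_fun_on V f" "F p \<in> V"
  shows "dir_deriv (\<lambda>q. f (F q)) v p = dir_deriv f (jac F v p) (F p)"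
  by (rule dir_deriv_eqI)
    (use has_derivative_compose[OF jac_has_derivative[OF assms(1,2)] hol_fun_on_has_derivative(1)[OF assms(3,4)]]
      in \<open>auto simp: jac_scale[OF assms(1,2)] hol_fun_on_has_derivative(2)[OF assms(3,4)]\<close>)

lemma jac_compose:
  fixes F :: "complex^'m \<Rightarrow> complex^'k" and G :: "complex^'k \<Rightarrow> complex^'l"
  assumes "hol_map_on U F" "p \<in> U" "hol_map_on V G" "F p \<in> V"
  shows "jac (\<lambda>q. G (F q)) v p = jac G (jac F v p) (F p)"
  using assms unfolding jac_def[of G] jac_def[of "\<lambda>q. G (F q)"]
  by (auto simp: vec_eq_iff hol_map_on_def intro!: dir_deriv_compose[where f = "\<lambda>q. G q $ i" for i])

lemma dir_deriv_cong:
  fixes f g :: "complex^'m \<Rightarrow> complex"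
  assumes "eventually (\<lambda>q. f q = g q) (nhds p)"
  shows "dir_deriv f v p = dir_deriv g v p"
proof -
  have "((\<lambda>t. p + t *s v) \<longlongrightarrow> p + 0 *s v) (nhds 0)"
    using has_derivative_continuous[OF slice_has_derivative[of p v 0]]
    unfolding isCont_def tendsto_at_iff_tendsto_nhds[of "\<lambda>t. p + t *s v"] .
  then have "filterlim (\<lambda>t. p + t *s v) (nhds p) (nhds 0)" by simp
  then have "eventually (\<lambda>t. f (p + t *s v) = g (p + t *s v)) (nhds 0)"
    using assms by (rule eventually_compose_filterlim[rotated])
  then show ?thesis unfolding dir_deriv_def by (rule deriv_cong_ev) simp
qed

lemma jac_cong: "eventually (\<lambda>q. F q = G q) (nhds p) \<Longrightarrow> jac F v p = jac G v p"
  unfolding jac_def by (auto simp: vec_eq_iff elim: eventually_mono intro!: dir_deriv_cong)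

lemma dir_deriv_nth: "dir_deriv (\<lambda>q. q $ i) v p = v $ i"
  by (rule dir_deriv_eqI) (auto intro!: bounded_linear_imp_has_derivative bounded_linear_vec_nth)

lemma jac_id: "jac (\<lambda>q. q) v p = v"
  by (simp add: jac_def dir_deriv_nth vec_eq_iff)

lemma jac_linear:
  fixes F :: "complex^'m \<Rightarrow> complex^'k"
  assumes "hol_map_on U F" "p \<in> U"
  shows "Vector_Spaces.linear (*s) (*s) (\<lambda>v. jac F v p)"
proof -
  interpret linear "\<lambda>v. jac F v p"
    using jac_has_derivative[OF assms] has_derivative_linear by blast
  show ?thesis
    by unfold_locales (simp_all add: add jac_scale[OF assms] vec_eq_iff algebra_simps)
qed

lemma continuous_on_jac:
  fixes F :: "complex^'m \<Rightarrow> complex^'k"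
  assumes "open U" "hol_map_on U F" "continuous_on S g" "continuous_on S w" "g ` S \<subseteq> U"
  shows "continuous_on S (\<lambda>x. jac F (w x) (g x))"
proof -
  have "continuous_on S (\<lambda>x. jac F (w x) (g x) $ i)" for i
  proof -
    have i: "hol_fun_on U (\<lambda>q. F q $ i)" using assms by (simp add: hol_map_on_def)
    have *: "continuous_on S (\<lambda>x. dir_deriv (\<lambda>q. F q $ i) (axis j 1) (g x))" for j
      using assms(3,5) hol_fun_on_continuous_on[OF hol_fun_on_dir_deriv[OF assms(1) i]]
      by (intro continuous_on_compose2[OF _ assms(3)]) auto
    have "continuous_on S (\<lambda>x. \<Sum>j\<in>UNIV. w x $ j * dir_deriv (\<lambda>q. F q $ i) (axis j 1) (g x))"
      by (intro continuous_intros * assms)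
    moreover have "jac F (w x) (g x) $ i = (\<Sum>j\<in>UNIV. w x $ j * dir_deriv (\<lambda>q. F q $ i) (axis j 1) (g x))"
      if "x \<in> S" for x
      unfolding jac_def using assms(5) that by (simp add: dir_deriv_sum[OF i, of "g x" "w x"] image_subset_iff)
    ultimately show ?thesis by (simp cong: continuous_on_cong)
  qed
  then show ?thesis using continuous_on_vec_lambda[of S "\<lambda>i x. jac F (w x) (g x) $ i"] by simp
qed

lemma curve_has_derivative:
  fixes \<gamma> :: "complex \<Rightarrow> complex^'m"
  assumes "\<And>i. (\<lambda>t. \<gamma> t $ i) holomorphic_on S" "open S" "t0 \<in> S"
  shows "(\<gamma> has_derivative (\<lambda>t. t *s (\<chi> i. deriv (\<lambda>t. \<gamma> t $ i) t0))) (at t0)"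
proof (rule has_derivative_componentwise_within[THEN iffD2, rule_format])
  fix b :: "complex^'m" assume "b \<in> Basis"
  then obtain i u where b: "b = axis i u" by (auto simp: Basis_vec_def)
  have "((\<lambda>t. \<gamma> t $ i) has_derivative (\<lambda>t. t * deriv (\<lambda>t. \<gamma> t $ i) t0)) (at t0)"
    using holomorphic_derivI[OF assms(1,2,3), of i UNIV]
    by (simp add: has_field_derivative_def mult_commute_abs)
  then show "((\<lambda>t. inner (\<gamma> t) b) has_derivative (\<lambda>t. inner (t *s (\<chi> i. deriv (\<lambda>t. \<gamma> t $ i) t0)) b)) (at t0)"
    by (simp add: b inner_axis has_derivative_inner_left)
qed

lemma curve_compose_DERIV:
  fixes \<gamma> :: "complex \<Rightarrow> complex^'m"
  assumes "\<And>i. (\<lambda>t. \<gamma> t $ i) holomorphic_on S" "open S" "t0 \<in> S" "hol_fun_on U f" "\<gamma> t0 \<in> U"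
  shows "((\<lambda>t. f (\<gamma> t)) has_field_derivative dir_deriv f (\<chi> i. deriv (\<lambda>t. \<gamma> t $ i) t0) (\<gamma> t0)) (at t0)"
  using has_derivative_compose[OF curve_has_derivative[OF assms(1-3)] hol_fun_on_has_derivative(1)[OF assms(4,5)]]
  by (simp add: has_field_derivative_def hol_fun_on_has_derivative(2)[OF assms(4,5)] mult_commute_abs)

lemma tangent_vectorsE:
  fixes v :: "complex^'m"
  assumes "v \<in> tangent_vectors X p"
  obtains r and \<gamma> :: "complex \<Rightarrow> complex^'m" where "r > 0" "\<And>i. (\<lambda>t. \<gamma> t $ i) holomorphic_on ball 0 r" "\<And>t. t \<in> ball 0 r \<Longrightarrow> \<gamma> t \<in> X"
    "\<gamma> 0 = p" "v = (\<chi> i. deriv (\<lambda>t. \<gamma> t $ i) 0)"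
proof -
  from assms obtain r and \<gamma> :: "complex \<Rightarrow> complex^'m" where
    "r > 0" "\<forall>i. (\<lambda>t. \<gamma> t $ i) holomorphic_on ball 0 r" "\<gamma> ` ball 0 r \<subseteq> X"
    "\<gamma> 0 = p" "\<forall>i. v $ i = deriv (\<lambda>t. \<gamma> t $ i) 0"
    unfolding tangent_vectors_def mem_Collect_eq by (elim exE conjE)
  then show ?thesis by (intro that[of r \<gamma>]) (auto simp: vec_eq_iff image_subset_iff)
qed

lemma tangent_vectorsI:
  fixes \<gamma> :: "complex \<Rightarrow> complex^'m"
  assumes "open S" "0 \<in> S" "\<And>i. (\<lambda>t. \<gamma> t $ i) holomorphic_on S" "\<And>t. t \<in> S \<Longrightarrow> \<gamma> t \<in> X"
    "\<gamma> 0 = p" "v = (\<chi> i. deriv (\<lambda>t. \<gamma> t $ i) 0)"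
  shows "v \<in> tangent_vectors X p"
proof -
  obtain r where "r > 0" "ball 0 r \<subseteq> S" using assms(1,2) open_contains_ball by blast
  then show ?thesis
    unfolding tangent_vectors_def using assms
    by (auto intro!: exI[of _ r] exI[of _ \<gamma>] intro: holomorphic_on_subset)
qed

lemma tangent_vectors_image:
  fixes G :: "complex^'m \<Rightarrow> complex^'k"
  assumes "v \<in> tangent_vectors X p" "open U" "hol_map_on U G" "p \<in> U" "\<And>q. q \<in> X \<inter> U \<Longrightarrow> G q \<in> Y"
  shows "jac G v p \<in> tangent_vectors Y (G p)"
proof -
  from assms(1) obtain r \<gamma> where \<gamma>: "r > 0" "\<And>i. (\<lambda>t. \<gamma> t $ i) holomorphic_on ball 0 r"
    "\<And>t. t \<in> ball 0 r \<Longrightarrow> \<gamma> t \<in> X" "\<gamma> 0 = p" "v = (\<chi> i. deriv (\<lambda>t. \<gamma> t $ i) 0)"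
    by (rule tangent_vectorsE) blast
  have "isCont \<gamma> t" if "t \<in> ball 0 r" for t
    using has_derivative_continuous[OF curve_has_derivative[OF \<gamma>(2) _ that]] by simp
  then have cont: "continuous_on (ball 0 r) \<gamma>" by (simp add: continuous_at_imp_continuous_on)
  define S where "S = ball 0 r \<inter> \<gamma> -` U"
  have S: "open S" "0 \<in> S" "S \<subseteq> ball 0 r" "\<And>t. t \<in> S \<Longrightarrow> \<gamma> t \<in> U"
    using assms(2,4) \<gamma>(1,4) continuous_on_open_vimage[of "ball 0 r" \<gamma>] cont
    by (auto simp: S_def Int_commute)
  have G: "hol_fun_on U (\<lambda>q. G q $ i)" for i using assms(3) by (simp add: hol_map_on_def)
  note D = curve_compose_DERIV[OF holomorphic_on_subset[OF \<gamma>(2) S(3)] S(1) _ G S(4)]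
  show ?thesis
  proof (rule tangent_vectorsI[OF S(1,2), of "\<lambda>t. G (\<gamma> t)"])
    show "(\<lambda>t. G (\<gamma> t) $ i) holomorphic_on S" for i
      unfolding holomorphic_on_open[OF S(1)] using D by blast
    show "jac G v p = (\<chi> i. deriv (\<lambda>t. G (\<gamma> t) $ i) 0)"
      unfolding jac_def using DERIV_imp_deriv[OF D[OF S(2) S(2)]] \<gamma>(4,5) by simp
  qed (use assms(5) \<gamma> S in auto)
qed

text \<open>
  This is the preceding lemma for the target variety \<open>{0}\<close> in the one-dimensional space
  \<open>complex^unit\<close>.
\<close>
lemma tangent_vectors_dir_deriv_0:
  assumes "v \<in> tangent_vectors X p" "open U" "hol_fun_on U f" "p \<in> U" "\<And>q. q \<in> X \<inter> U \<Longrightarrow> f q = 0"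
  shows "dir_deriv f v p = 0"
proof -
  have "jac (\<lambda>q. \<chi> i::unit. f q) v p \<in> tangent_vectors {0} (\<chi> i. f p)"
    by (rule tangent_vectors_image[OF assms(1,2) _ assms(4)]) (use assms in \<open>auto simp: hol_map_on_def vec_eq_iff\<close>)
  then obtain r \<gamma> where \<gamma>: "r > 0" "\<And>t. t \<in> ball 0 r \<Longrightarrow> \<gamma> t \<in> {0 :: complex^unit}"
     "jac (\<lambda>q. \<chi> i::unit. f q) v p = (\<chi> i. deriv (\<lambda>t. \<gamma> t $ i) 0)"
    by (rule tangent_vectorsE) blast
  have "dir_deriv f v p = deriv (\<lambda>t. \<gamma> t $ ()) 0"
    using \<gamma>(3) by (simp add: jac_def vec_eq_iff)
  also have "\<dots> = deriv (\<lambda>t. 0) 0"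
  proof (rule deriv_cong_ev)
    show "\<forall>\<^sub>F t in nhds 0. \<gamma> t $ () = 0"
      using eventually_nhds_in_open[of "ball 0 r" 0] \<gamma>(1,2) by (auto elim!: eventually_mono)
  qed simp
  finally show ?thesis by simp
qed

text \<open>
  Two local extensions agree along a holomorphic disc in \<open>X\<close>, hence so do their derivatives on the
  velocity of the disc. This makes the arbitrary choice in the definition of \<open>differential\<close>
  harmless.
\<close>
lemma differential_eq_jac:
  fixes G :: "complex^'m \<Rightarrow> complex^'k"
  assumes U: "open U" and G: "hol_map_on U G" and p: "p \<in> U" and eq: "\<And>q. q \<in> X \<inter> U \<Longrightarrow> F q = G q"
    and v: "v \<in> tangent_vectors X p"
  shows "differential X F p v = jac G v p"
proof -
  define P where "P = (\<lambda>D. \<exists>U G. local_extension X F p U G \<and> (G has_derivative D) (at p))"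
  have "P (\<lambda>v. jac G v p)"
    unfolding P_def local_extension_def using assms jac_has_derivative[OF G p] by blast
  then have "P (SOME D. P D)" by (rule someI[of P])
  moreover have "differential X F p = (SOME D. P D)" by (simp add: differential_def P_def)
  ultimately have "P (differential X F p)" by simp
  then obtain U' G' where U': "open U'" "p \<in> U'" "\<And>q. q \<in> X \<inter> U' \<Longrightarrow> F q = G' q"
    and G': "(G' has_derivative differential X F p) (at p)"
    unfolding P_def local_extension_def by auto
  from v obtain r \<gamma> where \<gamma>: "r > 0" "\<And>i. (\<lambda>t. \<gamma> t $ i) holomorphic_on ball 0 r"
    "\<And>t. t \<in> ball 0 r \<Longrightarrow> \<gamma> t \<in> X" "\<gamma> 0 = p" "v = (\<chi> i. deriv (\<lambda>t. \<gamma> t $ i) 0)"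
    by (rule tangent_vectorsE) blast
  have \<gamma>': "(\<gamma> has_derivative (\<lambda>t. t *s v)) (at 0)"
    using curve_has_derivative[OF \<gamma>(2), of 0] \<gamma>(1,5) by simp
  have 1: "((\<lambda>t. G' (\<gamma> t)) has_derivative (\<lambda>t. differential X F p (t *s v))) (at 0)"
    using has_derivative_compose[OF \<gamma>'] G' \<gamma>(4) by simp
  have 2: "((\<lambda>t. G (\<gamma> t)) has_derivative (\<lambda>t. jac G (t *s v) p)) (at 0)"
    using has_derivative_compose[OF \<gamma>'] jac_has_derivative[OF G p] \<gamma>(4) by simp
  have "isCont \<gamma> 0" using \<gamma>' by (rule has_derivative_continuous)
  then have "(\<gamma> \<longlongrightarrow> p) (nhds 0)" 
    using \<gamma>(4) tendsto_at_iff_tendsto_nhds[of \<gamma> 0] by (simp add: isCont_def)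
  then have "\<forall>\<^sub>F t in nhds 0. \<gamma> t \<in> U \<inter> U'"
    using U p U' by (intro topological_tendstoD) auto
  moreover have "\<forall>\<^sub>F t in nhds 0. t \<in> ball 0 r"
    using \<gamma>(1) by (intro eventually_nhds_in_open) auto
  ultimately have ev: "\<forall>\<^sub>F t in nhds 0. G' (\<gamma> t) = G (\<gamma> t)"
  proof eventually_elim
    case (elim t)
    then show ?case using \<gamma>(3)[of t] eq[of "\<gamma> t"] U'(3)[of "\<gamma> t"] by auto
  qed
  then have "((\<lambda>t. G (\<gamma> t)) has_derivative (\<lambda>t. differential X F p (t *s v))) (at 0)"
    by (intro has_derivative_transform_eventually[OF 1]) (auto simp: eventually_at_filter elim: eventually_mono dest: eventually_nhds_x_imp_x)
  from has_derivative_unique[OF this 2] show ?thesis by (metis vector_smult_lid)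
qed

section \<open>Charts of the regular part\<close>

text \<open>
  The data in the definition of a regular point. The inverse chart is a separate parameter \<open>\<psi>\<close>,
  so that a chart can be transported by an ambient automorphism.
\<close>
locale flat_chart =
  fixes X U V :: "(complex^'m) set" and \<phi> \<psi> :: "complex^'m \<Rightarrow> complex^'m" and I :: "'m set"
  assumes open_U: "open U" and open_V: "open V" and bij: "bij_betw \<phi> U V"
    and hol_\<phi>: "hol_map_on U \<phi>" and hol_\<psi>: "hol_map_on V \<psi>"
    and \<psi>_\<phi>: "\<And>q. q \<in> U \<Longrightarrow> \<psi> (\<phi> q) = q"
    and flat: "\<phi> ` (X \<inter> U) = {w \<in> V. \<forall>i. i \<notin> I \<longrightarrow> w $ i = 0}"
begin

lemma \<phi>_in: "q \<in> U \<Longrightarrow> \<phi> q \<in> V" and \<psi>_in: "w \<in> V \<Longrightarrow> \<psi> w \<in> U" and \<phi>_\<psi>: "w \<in> V \<Longrightarrow> \<phi> (\<psi> w) = w"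
  using bij \<psi>_\<phi> unfolding bij_betw_def by auto

lemma mem_iff: assumes "w \<in> V" shows "\<psi> w \<in> X \<longleftrightarrow> (\<forall>i. i \<notin> I \<longrightarrow> w $ i = 0)"
proof -
  have "\<psi> w \<in> X \<longleftrightarrow> w \<in> \<phi> ` (X \<inter> U)"
  proof
    assume "\<psi> w \<in> X"
    then show "w \<in> \<phi> ` (X \<inter> U)" using assms \<psi>_in \<phi>_\<psi> by (intro image_eqI[of _ _ "\<psi> w"]) auto
  qed (use \<psi>_\<phi> in auto)
  then show ?thesis using assms flat by simp
qed

lemma jac_\<psi>_\<phi>: assumes "q \<in> U" shows "jac \<psi> (jac \<phi> v q) (\<phi> q) = v"
proof -
  have "jac (\<lambda>q. \<psi> (\<phi> q)) v q = jac (\<lambda>q. q) v q"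
    using eventually_nhds_in_open[OF open_U assms] \<psi>_\<phi> by (intro jac_cong) (auto elim!: eventually_mono)
  then show ?thesis using jac_compose[OF hol_\<phi> assms hol_\<psi> \<phi>_in[OF assms], of v] by (simp add: jac_id)
qed

lemma jac_\<phi>_\<psi>: assumes "w \<in> V" shows "jac \<phi> (jac \<psi> v w) (\<psi> w) = v"
proof -
  have "jac (\<lambda>q. \<phi> (\<psi> q)) v w = jac (\<lambda>q. q) v w"
    using eventually_nhds_in_open[OF open_V assms] \<phi>_\<psi> by (intro jac_cong) (auto elim!: eventually_mono)
  then show ?thesis using jac_compose[OF hol_\<psi> assms hol_\<phi> \<psi>_in[OF assms], of v] by (simp add: jac_id)
qed

lemma jac_\<psi>_tangent:
  assumes "w \<in> V" "\<psi> w \<in> X" "\<And>i. i \<notin> I \<Longrightarrow> u $ i = 0"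
  shows "jac \<psi> u w \<in> tangent_vectors X (\<psi> w)"
proof (rule tangent_vectors_image[where U = V and X = "{w. \<forall>i. i \<notin> I \<longrightarrow> w $ i = 0}"])
  show "u \<in> tangent_vectors {w. \<forall>i. i \<notin> I \<longrightarrow> w $ i = 0} w"
  proof (rule tangent_vectorsI[of UNIV "\<lambda>t. w + t *s u"])
    show "u = (\<chi> i. deriv (\<lambda>t. (w + t *s u) $ i) 0)"
      by (auto simp: vec_eq_iff intro!: DERIV_imp_deriv[symmetric] derivative_eq_intros)
  qed (use assms mem_iff[OF assms(1)] in \<open>auto intro!: holomorphic_intros\<close>)
qed (use assms(1) open_V hol_\<psi> mem_iff in auto)

lemma jac_\<phi>_flat:
  assumes "v \<in> tangent_vectors X q" "q \<in> U" "i \<notin> I"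
  shows "jac \<phi> v q $ i = 0"
proof -
  have "dir_deriv (\<lambda>q. \<phi> q $ i) v q = 0"
    using assms(2,3) flat hol_\<phi> unfolding hol_map_on_def
    by (intro tangent_vectors_dir_deriv_0[OF assms(1) open_U]) auto
  then show ?thesis by (simp add: jac_def)
qed

text \<open>The field is constant in the coordinates of the chart.\<close>
lemma extend_tangent_vector:
  assumes "v \<in> tangent_vectors X p" "p \<in> U"
  obtains N where "N p = v" "continuous_on U N" "\<And>q. q \<in> X \<inter> U \<Longrightarrow> N q \<in> tangent_vectors X q"
proof (rule that[of "\<lambda>q. jac \<psi> (jac \<phi> v p) (\<phi> q)"])
  show "jac \<psi> (jac \<phi> v p) (\<phi> p) = v" using assms(2) by (rule jac_\<psi>_\<phi>)
  show "continuous_on U (\<lambda>q. jac \<psi> (jac \<phi> v p) (\<phi> q))"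
    by (rule continuous_on_jac[OF open_V hol_\<psi> hol_map_on_continuous_on[OF hol_\<phi>]]) (auto simp: \<phi>_in)
  show "jac \<psi> (jac \<phi> v p) (\<phi> q) \<in> tangent_vectors X q" if "q \<in> X \<inter> U" for q
    using jac_\<psi>_tangent[of "\<phi> q" "jac \<phi> v p"] that jac_\<phi>_flat[OF assms] by (auto simp: \<psi>_\<phi> \<phi>_in)
qed

lemma regular: "q \<in> X \<inter> U \<Longrightarrow> regular_at (card I) X q"
  unfolding regular_at_def
proof (rule conjI, simp, rule exI[of _ U], rule exI[of _ V], rule exI[of _ \<phi>], rule exI[of _ I], intro conjI)
  have "hol_fun_on V (\<lambda>w. inv_into U \<phi> w $ i)" for i
  proof (rule hol_fun_on_cong[OF open_V])
    show "hol_fun_on V (\<lambda>w. \<psi> w $ i)" using hol_\<psi> by (simp add: hol_map_on_def)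
    show "\<psi> w $ i = inv_into U \<phi> w $ i" if "w \<in> V" for w
      using bij that \<psi>_in \<phi>_\<psi> by (metis bij_betw_inv_into_left)
  qed
  then show "hol_map_on V (inv_into U \<phi>)" by (simp add: hol_map_on_def)
qed (use open_U open_V bij hol_\<phi> flat in auto)

text \<open>
  The chart provides a space of tangent vectors of dimension \<open>card I\<close>. It lies in the kernel of
  the derivative of \<open>f\<close>, a proper subspace, and the dimensions agree.
\<close>
lemma tangent_vectors_eq_kernel:
  assumes card: "Suc (card I) = CARD('m)" and p: "p \<in> X \<inter> U" and f: "open W" "hol_fun_on W f" "p \<in> W"
    "\<And>q. q \<in> X \<inter> W \<Longrightarrow> f q = 0" and nz: "dir_deriv f u p \<noteq> 0"
  shows "tangent_vectors X p = {v. dir_deriv f v p = 0}"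
proof (rule antisym)
  show "tangent_vectors X p \<subseteq> {v. dir_deriv f v p = 0}"
    using tangent_vectors_dir_deriv_0[OF _ f] by blast
  have pU: "p \<in> U" "\<phi> p \<in> V" using p \<phi>_in by auto
  define K where "K = {v. dir_deriv f v p = 0}"
  define F :: "(complex^'m) set" where "F = {w. \<forall>i. i \<notin> I \<longrightarrow> w $ i = 0}"
  define T where "T = (\<lambda>v. jac \<psi> v (\<phi> p)) ` F"
  have lin: "Vector_Spaces.linear (*s) (*s) (\<lambda>v. jac \<psi> v (\<phi> p))" by (rule jac_linear[OF hol_\<psi> pU(2)])
  have inj: "inj (\<lambda>v. jac \<psi> v (\<phi> p))"
    by (rule inj_on_inverseI[of _ "\<lambda>v. jac \<phi> v p"]) (use jac_\<phi>_\<psi>[OF pU(2)] \<psi>_\<phi>[OF pU(1)] in simp)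
  have F: "vec.subspace F" unfolding F_def by (auto simp: vec.subspace_def)
  have T: "vec.subspace T" "vec.dim T = card I"
    using vec.linear_subspace_image[OF lin F] vec.dim_image_eq[OF lin, of F] inj
    by (auto simp: T_def F_def dim_substandard_cart intro: inj_on_subset)
  have TX: "T \<subseteq> tangent_vectors X p"
    using jac_\<psi>_tangent[OF pU(2)] p \<psi>_\<phi>[OF pU(1)] by (auto simp: T_def F_def)
  then have TK: "T \<subseteq> K" using tangent_vectors_dir_deriv_0[OF _ f] by (auto simp: K_def)
  interpret linear "\<lambda>v. dir_deriv f v p" by (rule hol_fun_on_has_derivative(3)[OF f(2,3)])
  have K: "vec.subspace K"
    unfolding K_def vec.subspace_def by (simp add: zero add hol_fun_on_has_derivative(2)[OF f(2,3)])
  have "K \<noteq> UNIV" using nz by (auto simp: K_def)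
  then have "vec.dim K < vec.dim (UNIV :: (complex^'m) set)"
    using K by (intro vec.dim_psubset) (simp add: vec.span_eq_iff[THEN iffD2] psubset_eq)
  then have "vec.dim K \<le> vec.dim T" using T card unfolding vec_dim_card by simp
  then have "T = K" using vec.subspace_dim_equal[OF T(1) K TK] by simp
  then show "{v. dir_deriv f v p = 0} \<subseteq> tangent_vectors X p" using TX by (simp add: K_def)
qed

text \<open>
  In the chart \<open>X\<close> is the hyperplane where the coordinate \<open>k\<close> vanishes, and the equation becomes a
  function \<open>g\<close> whose zeros on each complex line in the direction \<open>e\<close> of this coordinate reduce to
  the point of the hyperplane. On a fixed circle around this point \<open>g\<close> is bounded below, uniformly
  for neighbouring lines, so by \<open>deriv_at_unique_zero_ge\<close> the derivative of \<open>g\<close> along \<open>e\<close> at points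
  of the hyperplane is either 0 or bounded away from 0. Being continuous and 0 at the given point,
  it is 0 nearby, and the derivatives of \<open>g\<close> along the hyperplane are 0 anyway.
\<close>
lemma gradient_vanishes_nearby:
  assumes card: "Suc (card I) = CARD('m)" and p: "p \<in> X \<inter> U"
    and f: "hol_fun_on UNIV f" "\<And>q. q \<in> X \<longleftrightarrow> f q = 0" and sing: "\<And>v. dir_deriv f v p = 0"
  shows "\<exists>W. open W \<and> p \<in> W \<and> (\<forall>q\<in>X \<inter> W. \<forall>v. dir_deriv f v q = 0)"
proof -
  have "card (UNIV - I) = 1" using card by (simp add: card_Diff_subset)
  then obtain k where k: "UNIV - I = {k}" by (auto simp: card_1_singleton_iff)
  then have mem: "\<psi> w \<in> X \<longleftrightarrow> w $ k = 0" if "w \<in> V" for w using mem_iff[OF that] by auto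
  define e :: "complex^'m" where "e = axis k 1"
  define g where "g = (\<lambda>w. f (\<psi> w))"
  have g: "hol_fun_on V g" unfolding g_def by (rule hol_fun_on_compose[OF hol_\<psi> f(1)]) auto
  have g0: "g w = 0 \<longleftrightarrow> w $ k = 0" if "w \<in> V" for w using mem[OF that] f(2) by (simp add: g_def)
  have dg: "dir_deriv g v w = dir_deriv f (jac \<psi> v w) (\<psi> w)" if "w \<in> V" for v w
    unfolding g_def using dir_deriv_compose[OF hol_\<psi> that f(1)] by simp
  define w0 where "w0 = \<phi> p"
  have w0: "w0 \<in> V" "w0 $ k = 0" "\<psi> w0 = p" using p \<phi>_in \<psi>_\<phi> mem[of w0] by (auto simp: w0_def)
  obtain R where R: "R > 0" "cball w0 R \<subseteq> V" using open_V w0(1) open_contains_cball by blast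
  have "norm e = 1" by (simp add: e_def norm_eq_sqrt_inner inner_axis_axis)
  then have ne: "norm (t *s e) = norm t" for t by (simp add: norm_smult_vec)
  define r where "r = R / 2"
  have r: "r > 0" "r < R" using R by (auto simp: r_def)
  \<comment> \<open>The radii of the two balls add up to \<open>R\<close>, and \<open>r\<close> lies below the second.\<close>
  have near: "w + t *s e \<in> V" if "dist w w0 < R / 4" "norm t < 3/4 * R" for w t
  proof -
    have "norm ((w - w0) + t *s e) \<le> norm (w - w0) + norm (t *s e)" by (rule norm_triangle_ineq)
    then have "dist (w + t *s e) w0 \<le> R" using that by (simp add: ne dist_norm algebra_simps)
    then show ?thesis using R(2) by (auto simp: dist_commute)
  qed
  define C where "C = (\<lambda>t. w0 + t *s e) ` sphere 0 r"
  have C: "compact C" "C \<subseteq> V" "\<And>c. c \<in> C \<Longrightarrow> g c \<noteq> 0" "C \<noteq> {}"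
  proof -
    show "compact C" unfolding C_def by (intro compact_continuous_image continuous_intros) auto
    show CV: "C \<subseteq> V" using near[of w0] R by (auto simp: C_def r_def)
    fix c assume c: "c \<in> C"
    then obtain t where "norm t = r" "c = w0 + t *s e" by (auto simp: C_def)
    then have "c $ k \<noteq> 0" using w0 r by (auto simp: e_def)
    then show "g c \<noteq> 0" using g0 c CV by blast
  qed (use r in \<open>auto simp: C_def\<close>)
  have "continuous_on C (\<lambda>c. norm (g c))"
    using hol_fun_on_continuous_on[OF g] C(2) by (intro continuous_intros) (auto intro: continuous_on_subset)
  from continuous_attains_inf[OF C(1,4) this] obtain c0 where c0: "c0 \<in> C" "\<And>c. c \<in> C \<Longrightarrow> norm (g c0) \<le> norm (g c)"
    by blast
  define \<delta> where "\<delta> = norm (g c0) / 2"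
  have \<delta>: "\<delta> > 0" "\<And>c. c \<in> C \<Longrightarrow> 2 * \<delta> \<le> norm (g c)" using c0 C(3) by (auto simp: \<delta>_def)
  have uc: "uniformly_continuous_on (cball w0 R) g"
    using hol_fun_on_continuous_on[OF g] R(2) by (intro compact_uniformly_continuous) (auto intro: continuous_on_subset)
  then obtain d where d: "d > 0" "\<And>x y. x \<in> cball w0 R \<Longrightarrow> y \<in> cball w0 R \<Longrightarrow> dist y x < d \<Longrightarrow> dist (g y) (g x) < \<delta>"
    unfolding uniformly_continuous_on_def using \<delta>(1) by metis
  have lower: "norm (g (w + t *s e)) \<ge> \<delta>" if w: "dist w w0 < min d (R/4)" and t: "norm t = r" for w t
  proof -
    have "dist (w + t *s e) w0 \<le> R" 
      using near[of w t] norm_triangle_ineq[of "w - w0" "t *s e"] w t R(1)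
      by (simp add: ne dist_norm algebra_simps r_def)
    moreover have "dist (w0 + t *s e) w0 \<le> R" using t r by (simp add: ne dist_norm)
    ultimately have "dist (g (w + t *s e)) (g (w0 + t *s e)) < \<delta>"
      using w by (intro d) (auto simp: dist_commute dist_norm)
    moreover have "2 * \<delta> \<le> norm (g (w0 + t *s e))" using t by (intro \<delta>) (auto simp: C_def)
    ultimately show ?thesis 
      using norm_triangle_sub[of "g (w0 + t *s e)" "g (w + t *s e)"] by (simp add: dist_norm norm_minus_commute)
  qed
  have dichotomy: "dir_deriv g e w = 0 \<or> norm (dir_deriv g e w) \<ge> \<delta> / r"
    if w: "dist w w0 < min d (R/4)" "w $ k = 0" for w
  proof (rule disjCI)
    assume nz: "\<not> norm (dir_deriv g e w) \<ge> \<delta> / r"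
    show "dir_deriv g e w = 0"
    proof (rule ccontr)
      assume "dir_deriv g e w \<noteq> 0"
      then have "\<delta> / r \<le> norm (deriv (\<lambda>t. g (w + t *s e)) 0)"
      proof (intro deriv_at_unique_zero_ge)
        show "(\<lambda>t. g (w + t *s e)) holomorphic_on ball 0 (3/4 * R)"
          using w by (intro slice_holomorphic[OF hol_fun_on_differentiable_along[OF g]] near) auto
        fix t :: complex assume "norm t \<le> r"
        then have "w + t *s e \<in> V" using w r R by (intro near) (auto simp: r_def)
        then show "g (w + t *s e) = 0 \<longleftrightarrow> t = 0" using w(2) by (auto simp: g0 e_def)
      qed (use w lower r \<delta> R in \<open>auto simp: dir_deriv_def r_def\<close>)
      then show False using nz by (simp add: dir_deriv_def)
    qed
  qed
  have cont: "isCont (dir_deriv g e) w0"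
    using hol_fun_on_continuous_on[OF hol_fun_on_dir_deriv[OF open_V g]] open_V w0(1)
    by (simp add: continuous_on_eq_continuous_at)
  have "dir_deriv g e w0 = 0" using dg[OF w0(1)] w0(3) sing by simp
  then obtain d' where d': "d' > 0" "\<And>w. dist w w0 < d' \<Longrightarrow> norm (dir_deriv g e w) < \<delta> / r"
    using cont[unfolded continuous_at_eps_delta, rule_format, of "\<delta> / r"] r \<delta>(1)
    by (auto simp: dist_norm)
  define \<epsilon> where "\<epsilon> = min d' (min d (R/4))"
  have \<epsilon>: "\<epsilon> > 0" using d d' R by (simp add: \<epsilon>_def)
  have ge0: "dir_deriv g e w = 0" if "dist w w0 < \<epsilon>" "w $ k = 0" for w
    using dichotomy[of w] d'(2)[of w] that by (auto simp: \<epsilon>_def)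
  have all0: "dir_deriv f v (\<psi> w) = 0" if w: "dist w w0 < \<epsilon>" "w $ k = 0" "w \<in> V" for w v
  proof -
    have "\<psi> w \<in> X" using mem w by blast
    have gi: "dir_deriv g (axis i 1) w = 0" for i
    proof (cases "i = k")
      case True then show ?thesis using ge0[OF w(1,2)] by (simp add: e_def)
    next
      case False
      have "jac \<psi> (axis i 1) w \<in> tangent_vectors X (\<psi> w)"
        using \<open>\<psi> w \<in> X\<close> False k by (intro jac_\<psi>_tangent w) (auto simp: axis_def)
      from tangent_vectors_dir_deriv_0[OF this open_UNIV f(1)] dg[OF w(3)] f(2) show ?thesis by simp
    qed
    have "dir_deriv g (jac \<phi> v (\<psi> w)) w = 0" using dir_deriv_sum[OF g w(3)] gi by simp
    then show ?thesis using dg[OF w(3)] jac_\<psi>_\<phi>[OF \<psi>_in[OF w(3)]] by (simp add: \<phi>_\<psi>[OF w(3)])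
  qed
  define W where "W = U \<inter> \<phi> -` ball w0 \<epsilon>"
  have "open W" unfolding W_def using hol_map_on_continuous_on[OF hol_\<phi>] open_U
    by (metis Int_commute continuous_on_open_vimage open_ball)
  moreover have "p \<in> W" using p \<epsilon> by (auto simp: W_def w0_def)
  moreover have "dir_deriv f v q = 0" if q: "q \<in> X \<inter> W" for q v
  proof -
    have "\<phi> q \<in> V" "dist (\<phi> q) w0 < \<epsilon>" "\<psi> (\<phi> q) = q" using q \<phi>_in \<psi>_\<phi> by (auto simp: W_def dist_commute)
    then show ?thesis using all0[of "\<phi> q" v] mem[of "\<phi> q"] q by simp
  qed
  ultimately show ?thesis by blast
qed

end

lemma regular_atE:
  fixes p :: "complex^'m"
  assumes "regular_at d X p"
  obtains U V \<phi> \<psi> I where "flat_chart X U V \<phi> \<psi> I" "p \<in> X \<inter> U" "card I = d"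
proof -
  have "\<exists>U V. \<exists>\<phi> :: complex^'m \<Rightarrow> complex^'m. \<exists>I. open U \<and> p \<in> U \<and> open V \<and> bij_betw \<phi> U V \<and>
        hol_map_on U \<phi> \<and> hol_map_on V (inv_into U \<phi>) \<and>
        card I = d \<and> \<phi> ` (X \<inter> U) = {w \<in> V. \<forall>i. i \<notin> I \<longrightarrow> w $ i = 0}" and p: "p \<in> X"
    using assms unfolding regular_at_def by simp_all
  then show ?thesis
  proof (elim exE conjE)
    fix U V :: "(complex^'m) set" and \<phi> :: "complex^'m \<Rightarrow> complex^'m" and I
    assume *: "open U" "p \<in> U" "open V" "bij_betw \<phi> U V" "hol_map_on U \<phi>" "hol_map_on V (inv_into U \<phi>)"
      "card I = d" "\<phi> ` (X \<inter> U) = {w \<in> V. \<forall>i. i \<notin> I \<longrightarrow> w $ i = 0}"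
    show ?thesis
    proof (rule that)
      show "flat_chart X U V \<phi> (inv_into U \<phi>) I"
        using * by (simp add: flat_chart_def bij_betw_inv_into_left)
    qed (use * p in auto)
  qed
qed

lemma regular_at_image:
  assumes G: "hol_map_on UNIV G" "hol_map_on UNIV H" "\<And>q. H (G q) = q" "\<And>q. G (H q) = q" "G ` X = X"
    and p: "regular_at d X p"
  shows "regular_at d X (G p)"
proof -
  from p obtain U V \<phi> \<psi> I where c: "flat_chart X U V \<phi> \<psi> I" and p: "p \<in> X \<inter> U" and "card I = d"
    by (rule regular_atE)
  interpret flat_chart X U V \<phi> \<psi> I by (rule c)
  have GU: "G ` U = H -` U" 
  proof (intro set_eqI iffI)
    fix x assume "x \<in> H -` U"
    then show "x \<in> G ` U" using G(4)[of x] by (intro image_eqI[of _ _ "H x"]) auto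
  qed (use G(3) in auto)
  interpret c': flat_chart X "G ` U" V "\<lambda>q. \<phi> (H q)" "\<lambda>w. G (\<psi> w)" I
  proof
    show "open (G ` U)" unfolding GU
      using open_U hol_map_on_continuous_on[OF G(2)] by (simp add: open_vimage)
    show "bij_betw (\<lambda>q. \<phi> (H q)) (G ` U) V"
    proof -
      have "bij_betw H (G ` U) U" by (rule bij_betwI[of _ _ _ G]) (auto simp: G)
      from bij_betw_trans[OF this bij] show ?thesis by (simp add: comp_def)
    qed
    show "hol_map_on (G ` U) (\<lambda>q. \<phi> (H q))"
      by (rule hol_map_on_compose[OF _ hol_\<phi>, of _ H]) (use G in \<open>auto simp: hol_map_on_def intro: hol_fun_on_subset\<close>)
    show "hol_map_on V (\<lambda>w. G (\<psi> w))"
      by (rule hol_map_on_compose[OF hol_\<psi> G(1)]) auto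
    have "X \<inter> G ` U = G ` (X \<inter> U)"
      using G(3,5) by (metis image_Int inj_on_inverseI)
    then have "(\<lambda>q. \<phi> (H q)) ` (X \<inter> G ` U) = \<phi> ` (X \<inter> U)" by (simp add: image_image G)
    then show "(\<lambda>q. \<phi> (H q)) ` (X \<inter> G ` U) = {w \<in> V. \<forall>i. i \<notin> I \<longrightarrow> w $ i = 0}" using flat by simp
  qed (use G open_V \<psi>_\<phi> in auto)
  show ?thesis using c'.regular[of "G p"] p G(5) \<open>card I = d\<close> by blast
qed

section \<open>The equation and the hyperplane over the origin\<close>

text \<open>
  On the complex line through \<open>z0\<close> and \<open>z\<close> the function \<open>h\<close> is the locally uniform limit,
  as \<open>x\<close> tends to 0, of functions without zeros. By Hurwitz's theorem it has no zeros or is constant; it vanishes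
  at \<open>z0\<close>.
\<close>
lemma vanishes_near_zero_of_limit:
  fixes h k :: "complex^'n \<Rightarrow> complex"
  assumes h: "hol_fun_on UNIV h" and k: "hol_fun_on UNIV k" and s: "s > 0"
    and nz: "\<And>x z. x \<noteq> 0 \<Longrightarrow> norm x < s \<Longrightarrow> dist z z0 < s \<Longrightarrow> h z + x * k z + x\<^sup>2 * c \<noteq> 0"
    and h0: "h z0 = 0" and z: "dist z z0 < s"
  shows "h z = 0"
proof (cases "z = z0")
  case False
  define v where "v = z - z0"
  have v: "norm v > 0" "norm v < s" using False z by (auto simp: v_def dist_norm)
  define S where "S = ball (0::complex) (s / norm v)"
  have S: "0 \<in> S" "1 \<in> S" using v s by (auto simp: S_def)
  have inS: "dist (z0 + t *s v) z0 < s" if "t \<in> S" for t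
    using that v by (simp add: S_def dist_norm norm_smult_vec pos_less_divide_eq)
  define H where "H = (\<lambda>t. h (z0 + t *s v))"
  define K where "K = (\<lambda>t. k (z0 + t *s v))"
  have H: "H holomorphic_on S" and K: "K holomorphic_on S"
    unfolding H_def K_def by (auto intro: slice_holomorphic[OF hol_fun_on_differentiable_along[OF h]] slice_holomorphic[OF hol_fun_on_differentiable_along[OF k]])
  define x where "x = (\<lambda>n::nat. complex_of_real (s / real (n + 2)))"
  have x: "x n \<noteq> 0" "norm (x n) < s" for n
  proof -
    show "x n \<noteq> 0" using s by (simp add: x_def del: of_nat_Suc of_nat_add)
    have "norm (x n) = s / real (n + 2)" using s unfolding x_def norm_of_real by simp
    also have "\<dots> < s" using s by (simp add: field_simps add_pos_nonneg)
    finally show "norm (x n) < s" .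
  qed
  have x0: "x \<longlonglongrightarrow> 0"
  proof -
    have "(\<lambda>n. s / real (n + 2)) \<longlonglongrightarrow> 0" 
      by (rule LIMSEQ_ignore_initial_segment[of "\<lambda>n. s / real n" 0 2]) (rule lim_const_over_n)
    from tendsto_of_real[OF this, where 'a = complex] show ?thesis unfolding x_def of_real_0 .
  qed
  have "H constant_on S"
  proof (rule ccontr)
    assume nc: "\<not> H constant_on S"
    have "H 0 \<noteq> 0"
    proof (rule Hurwitz_no_zeros[of S "\<lambda>n t. H t + x n * K t + (x n)\<^sup>2 * c" H])
      show "open S" "connected S" by (auto simp: S_def)
      show "(\<lambda>t. H t + x n * K t + (x n)\<^sup>2 * c) holomorphic_on S" for n
        using H K by (intro holomorphic_intros)
      show "H t + x n * K t + (x n)\<^sup>2 * c \<noteq> 0" if "t \<in> S" for n t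
        unfolding H_def K_def using inS[OF that] x by (intro nz)
      fix L assume L: "compact L" "L \<subseteq> S"
      have "bounded (K ` L)"
        using K L by (intro compact_imp_bounded compact_continuous_image) (auto intro: holomorphic_on_imp_continuous_on holomorphic_on_subset)
      then obtain M where M: "\<And>t. t \<in> L \<Longrightarrow> norm (K t) \<le> M" by (auto simp: bounded_iff)
      have "(\<lambda>n. norm (x n) * M + (norm (x n))\<^sup>2 * norm c) \<longlonglongrightarrow> norm (0::complex) * M + (norm (0::complex))\<^sup>2 * norm c"
        using x0 by (intro tendsto_intros)
      then have lim: "(\<lambda>n. norm (x n) * M + (norm (x n))\<^sup>2 * norm c) \<longlonglongrightarrow> 0" by simp
      show "uniform_limit L (\<lambda>n t. H t + x n * K t + (x n)\<^sup>2 * c) H sequentially"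
      proof (rule uniform_limitI)
        fix e :: real assume "e > 0"
        then have "\<forall>\<^sub>F n in sequentially. norm (x n) * M + (norm (x n))\<^sup>2 * norm c < e"
          using lim by (intro order_tendstoD)
        then show "\<forall>\<^sub>F n in sequentially. \<forall>t\<in>L. dist (H t + x n * K t + (x n)\<^sup>2 * c) (H t) < e"
        proof eventually_elim
          case (elim n)
          show ?case
          proof
            fix t assume t: "t \<in> L"
            have "norm (x n * K t + (x n)\<^sup>2 * c) \<le> norm (x n) * M + (norm (x n))\<^sup>2 * norm c"
              using M[OF t] by (intro norm_triangle_mono) (auto simp: norm_mult norm_power mult_left_mono)
            then show "dist (H t + x n * K t + (x n)\<^sup>2 * c) (H t) < e" using elim
              by (simp add: dist_norm add.assoc)
          qed
        qed
      qed
    qed (use H nc S in auto)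
    then show False using h0 by (simp add: H_def)
  qed
  then have "H 1 = H 0" using S by (auto simp: constant_on_def)
  then show ?thesis using h0 by (simp add: H_def v_def)
qed (use h0 in simp)

definition coord_z :: "complex^('n coord) \<Rightarrow> complex^'n" where
  "coord_z p = (\<chi> i. p $ Cz i)"

definition eqn :: "(complex^'n \<Rightarrow> complex) \<Rightarrow> (complex^'n \<Rightarrow> complex) \<Rightarrow> complex^('n coord) \<Rightarrow> complex" where
  "eqn a b p = (p $ Cx)\<^sup>2 * p $ Cy - a (coord_z p) - p $ Cx * b (coord_z p)"

lemma coord_z_nth [simp]: "coord_z p $ i = p $ Cz i"
  by (simp add: coord_z_def)

lemma X_var_iff: "p \<in> X_var a b \<longleftrightarrow> eqn a b p = 0"
  by (simp add: X_var_def eqn_def coord_z_def Let_def algebra_simps)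

lemma hol_coord_z: "hol_map_on U coord_z"
  by (simp add: hol_map_on_def hol_fun_on_nth)

lemma norm_less_of_components:
  fixes v :: "complex^'m"
  assumes "\<And>i. norm (v $ i) < e / CARD('m)"
  shows "norm v < e"
proof -
  have "norm v \<le> (\<Sum>i\<in>UNIV. norm (v $ i))"
    unfolding norm_vec_def by (rule L2_set_le_sum) simp
  also have "\<dots> < real CARD('m) * (e / CARD('m))"
    by (rule sum_bounded_above_strict) (use assms in auto)
  finally show ?thesis by simp
qed

locale X_variety =
  fixes a b :: "complex^'n \<Rightarrow> complex"
  assumes a: "hol_fun_on UNIV a" and b: "hol_fun_on UNIV b"
begin

abbreviation "f \<equiv> eqn a b"
abbreviation "X \<equiv> X_var a b"
abbreviation "grad p k \<equiv> dir_deriv (eqn a b) (axis k 1) p"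

lemma hol_eqn: "hol_fun_on UNIV f"
  using hol_fun_on_compose[OF hol_coord_z a] hol_fun_on_compose[OF hol_coord_z b]
  unfolding eqn_def[abs_def] by (intro hol_fun_intros) auto

lemma grad_Cy: "grad p Cy = (p $ Cx)\<^sup>2"
proof -
  have "coord_z (p + t *s axis Cy 1) = coord_z p" for t
    by (simp add: vec_eq_iff axis_def)
  then have "f (p + t *s axis Cy 1) = f p + t * (p $ Cx)\<^sup>2" for t
    by (simp add: eqn_def axis_def algebra_simps)
  then show ?thesis unfolding dir_deriv_def
    by (auto intro!: DERIV_imp_deriv derivative_eq_intros)
qed

lemma grad_tangent:
  assumes "v \<in> tangent_vectors X p" 
  shows "(\<Sum>c\<in>UNIV. v $ c * grad p c) = 0"
proof -
  have "p \<in> X" using assms by (auto elim!: tangent_vectorsE)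
  have "dir_deriv f v p = 0"
    by (rule tangent_vectors_dir_deriv_0[OF assms open_UNIV hol_eqn]) (auto simp: X_var_iff)
  then show ?thesis using dir_deriv_sum[OF hol_eqn, of p v] by simp
qed

text \<open>
  If \<open>X\<close> has no points with \<open>x \<noteq> 0\<close> near \<open>p\<close>, then for fixed \<open>y\<close> and small nonzero \<open>x\<close> the
  expression \<open>a(z) + x b(z) - x^2 y\<close> has no zeros, so \<open>vanishes_near_zero_of_limit\<close> applies to \<open>a\<close>.
\<close>
lemma locally_x_eq_0:
  assumes p: "p \<in> X" "p $ Cx = 0" "p \<notin> closure {q \<in> X. q $ Cx \<noteq> 0}"
  obtains W where "open W" "p \<in> W" "\<And>q. q \<in> W \<Longrightarrow> q \<in> X \<longleftrightarrow> q $ Cx = 0"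
    "\<And>q. q \<in> W \<Longrightarrow> \<forall>\<^sub>F z in nhds (coord_z q). a z = 0"
proof -
  obtain e where e: "e > 0" "\<And>q. dist q p < e \<Longrightarrow> q \<in> X \<Longrightarrow> q $ Cx = 0"
    using p(3) unfolding closure_approachable by auto
  define s where "s = e / CARD('n coord)"
  have s: "s > 0" using e by (simp add: s_def)
  define z0 where "z0 = coord_z p"
  have a0: "a z = 0" if "dist z z0 < s" for z
  proof (rule vanishes_near_zero_of_limit[OF a b s _ _ that])
    show "a z0 = 0" using p(1,2) by (simp add: X_var_iff eqn_def z0_def)
    fix x :: complex and z assume x: "x \<noteq> 0" "norm x < s" "dist z z0 < s"
    define q :: "complex^('n coord)" where "q = (\<chi> c. case c of Cx \<Rightarrow> x | Cy \<Rightarrow> p $ Cy | Cz i \<Rightarrow> z $ i)"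
    have qz: "coord_z q = z" by (simp add: q_def vec_eq_iff)
    have "norm ((q - p) $ c) < s" for c
    proof (cases c)
      case (Cz i)
      have "norm ((z - z0) $ i) < s" using Finite_Cartesian_Product.norm_nth_le[of "z - z0" i] x(3) by (simp add: dist_norm)
      then show ?thesis by (simp add: Cz q_def z0_def)
    qed (use x s p in \<open>auto simp: q_def\<close>)
    then have "dist q p < e" unfolding dist_norm s_def by (rule norm_less_of_components)
    moreover have "q $ Cx = x" by (simp add: q_def)
    ultimately have "f q \<noteq> 0" using e(2) x(1) by (auto simp: X_var_iff)
    then show "a z + x * b z + x\<^sup>2 * (- p $ Cy) \<noteq> 0"
      by (simp add: eqn_def qz) (simp add: q_def algebra_simps)
  qed
  define W where "W = ball p e \<inter> coord_z -` ball z0 s"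
  show ?thesis
  proof (rule that[of W])
    show "open W" unfolding W_def using hol_map_on_continuous_on[OF hol_coord_z[of UNIV]]
      by (intro open_Int open_vimage) auto
    show "p \<in> W" using e s by (simp add: W_def z0_def)
    fix q assume q: "q \<in> W"
    show "q \<in> X \<longleftrightarrow> q $ Cx = 0"
      using q e(2)[of q] a0[of "coord_z q"] by (auto simp: W_def dist_commute X_var_iff eqn_def)
    have "\<forall>\<^sub>F z in nhds (coord_z q). z \<in> ball z0 s"
      using q by (intro eventually_nhds_in_open) (auto simp: W_def)
    then show "\<forall>\<^sub>F z in nhds (coord_z q). a z = 0"
      by eventually_elim (use a0 in \<open>auto simp: dist_commute\<close>)
  qed
qed

end

section \<open>The residue form\<close>

text \<open>
  An enumeration of the coordinates other than \<open>k\<close>. For \<open>k = Cy\<close> it is the one used in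
  \<open>is_omega\<close>; otherwise \<open>Cy\<close> takes the place of \<open>k\<close>, so that the minors for different \<open>k\<close>
  share most of their columns in the same places.
\<close>
definition omit :: "'n coord \<Rightarrow> 'n option \<Rightarrow> 'n coord" where
  "omit k m = (if case_option Cx Cz m = k then Cy else case_option Cx Cz m)"

lemma omit_Cy: "omit Cy = case_option Cx Cz"
  by (auto simp: omit_def fun_eq_iff split: option.split)

lemma omit_neq: "omit k m \<noteq> k"
  by (auto simp: omit_def split: option.splits)

lemma inj_omit: "inj (omit k)"
proof (rule injI)
  fix m m' assume "omit k m = omit k m'"
  then show "m = m'"
    by (cases m; cases m') (auto simp: omit_def split: if_splits)
qed

text \<open>
  With this sign the minors of vectors in the kernel of a linear form are proportional to the
  coefficients of the form.
\<close>
definition minor :: "'n coord \<Rightarrow> ('n::finite option \<Rightarrow> complex^('n coord)) \<Rightarrow> complex" where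
  "minor k v = (if k = Cy then 1 else -1) * coord_wedge (omit k) v"

lemma coord_wedge_rows: "coord_wedge J v = det (\<chi> j. \<chi> i. v i $ J j)"
proof -
  have "(\<chi> i j. v i $ J j) = transpose (\<chi> j. \<chi> i. v i $ J j)" by (simp add: transpose_def)
  then show ?thesis unfolding coord_wedge_def by (simp add: det_transpose)
qed

text \<open>
  Cramer's rule: expand the left-hand side by the dependence relation; the terms with a repeated
  row vanish.
\<close>
lemma det_replace_row_dependent:
  fixes A :: "'k::finite \<Rightarrow> complex^'k"
  assumes "(\<Sum>j\<in>UNIV. c j *s A j) + d *s u = 0"
  shows "d * det (\<chi> j. if j = k then u else A j) = - c k * det (\<chi> j. A j)"
proof -
  define D where "D = (\<lambda>u. det (\<chi> j. if j = k then u else A j))"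
  have D_scale: "D (e *s w) = e * D w" for e w
    unfolding D_def using det_row_mul[of k e "\<lambda>_. w" A] .
  have D_sum: "D (\<Sum>i\<in>UNIV. g i) = (\<Sum>i\<in>UNIV. D (g i))" for g :: "'k \<Rightarrow> complex^'k"
    unfolding D_def using det_linear_row_sum[of UNIV k "\<lambda>_. g" A] by simp
  have D0: "D (A j) = 0" if "j \<noteq> k" for j
    unfolding D_def using that by (intro det_identical_rows[of k j]) (auto simp: row_def vec_eq_iff)
  have Dk: "D (A k) = det (\<chi> j. A j)"
    unfolding D_def by (rule arg_cong[of _ _ det]) (simp add: vec_eq_iff)
  have "d *s u = (\<Sum>j\<in>UNIV. (- c j) *s A j)"
  proof (subst vec_eq_iff, intro allI)
    fix i
    have "(\<Sum>j\<in>UNIV. c j * A j $ i) + d * u $ i = 0"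
      using arg_cong[OF assms, of "\<lambda>x. x $ i"] by simp
    from minus_unique[OF this] show "(d *s u) $ i = (\<Sum>j\<in>UNIV. (- c j) *s A j) $ i"
      by (simp add: sum_negf)
  qed
  then have "d * D u = (\<Sum>j\<in>UNIV. (- c j) * D (A j))"
    unfolding D_scale[symmetric] D_sum[symmetric] by simp
  also have "\<dots> = (\<Sum>j\<in>{k}. (- c j) * D (A j))"
    by (rule sum.mono_neutral_right) (use D0 in auto)
  finally show ?thesis using Dk by (simp add: D_def)
qed

lemma UNIV_coord: "UNIV = insert Cy (range (case_option Cx Cz))"
  by (auto simp: image_iff) (metis coord.exhaust option.simps(4,5))

text \<open>
  If the rows of \<open>v\<close> are annihilated by \<open>g\<close>, then the columns of \<open>v\<close> satisfy one linear relation
  with coefficients \<open>g\<close>. Cramer's rule compares the minor omitting \<open>Cy\<close> with the others. Applied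
  to the columns in which \<open>R Cy\<close> has replaced the column \<open>i\<close>, it compares two others with each
  other; this is what remains to be used where \<open>g Cy = x^2\<close> vanishes.
\<close>
lemma minor_relation:
  fixes v :: "'n::finite option \<Rightarrow> complex^('n coord)"
  assumes rel: "\<And>m. (\<Sum>c\<in>UNIV. v m $ c * g c) = 0"
  shows "g k * minor l v = g l * minor k v"
proof -
  define J where "J = (case_option Cx Cz :: 'n option \<Rightarrow> 'n coord)"
  define R where "R = (\<lambda>c. \<chi> m. v m $ c)"
  define A where "A = (\<lambda>j. R (J j))"
  have injJ: "inj J" by (auto simp: J_def inj_def split: option.splits)
  have "(\<Sum>c\<in>UNIV. g c *s R c) = 0"
    using rel by (simp add: vec_eq_iff R_def mult.commute)
  moreover have "Cy \<notin> range J" by (auto simp: J_def split: option.splits)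
  ultimately have rel': "(\<Sum>j\<in>UNIV. g (J j) *s A j) + g Cy *s R Cy = 0"
    unfolding UNIV_coord J_def[symmetric] A_def by (simp add: sum.reindex[OF injJ] add.commute)
  have minor_Cy: "minor Cy v = det (\<chi> j. A j)"
    by (simp add: minor_def omit_Cy coord_wedge_rows A_def R_def J_def)
  have minor_J: "minor (J j) v = - det (\<chi> i. if i = j then R Cy else A i)" for j
  proof -
    have "omit (J j) i = (if i = j then Cy else J i)" for i
      using injJ by (auto simp: omit_def J_def inj_def)
    then have "(\<chi> i. \<chi> m. v m $ omit (J j) i) = (\<chi> i. if i = j then R Cy else A i)"
      by (auto simp: vec_eq_iff A_def R_def)
    moreover have "J j \<noteq> Cy" by (auto simp: J_def split: option.splits)
    ultimately show ?thesis by (simp add: minor_def coord_wedge_rows)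
  qed
  have 1: "g Cy * minor (J j) v = g (J j) * minor Cy v" for j
    using det_replace_row_dependent[OF rel', of j] by (simp add: minor_Cy minor_J)
  have 2: "g (J i) * minor (J j) v = g (J j) * minor (J i) v" for i j
  proof (cases "i = j")
    case False
    define B where "B = (\<lambda>m. if m = i then R Cy else A m)"
    define c where "c = (\<lambda>m. if m = i then g Cy else g (J m))"
    have "(\<Sum>m\<in>UNIV. c m *s B m) + g (J i) *s A i = (\<Sum>j\<in>UNIV. g (J j) *s A j) + g Cy *s R Cy"
      by (simp add: sum.remove[of UNIV i] B_def c_def)
    then have "g (J i) * det (\<chi> m. if m = j then A i else B m) = - c j * det (\<chi> m. B m)"
      using rel' by (intro det_replace_row_dependent) simp
    moreover have "det (\<chi> m. if m = j then A i else B m) = - det (\<chi> m. if m = j then R Cy else A m)"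
    proof -
      define M where "M = (\<chi> m. if m = j then R Cy else A m)"
      have "(\<chi> m. if m = j then A i else B m) = (\<chi> m. M $ Transposition.transpose i j m)"
        using False by (auto simp: M_def B_def vec_eq_iff Transposition.transpose_def)
      then show ?thesis 
        using det_permute_rows[of "Transposition.transpose i j" M] False
        by (simp add: M_def permutes_swap_id sign_swap_id)
    qed
    ultimately show ?thesis using False by (simp add: minor_J c_def B_def)
  qed simp
  have cases: "c = Cy \<or> (\<exists>j. c = J j)" for c
    using UNIV_coord unfolding J_def by (metis (no_types) UNIV_I imageE insertE)
  show ?thesis using cases[of k] cases[of l] 1 2 by (metis mult.commute)
qed

lemma coord_wedge_dual:
  assumes "\<And>i j. v i $ J j = (if i = j then 1 else 0)"
  shows "coord_wedge J v = 1"
proof -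
  have "(\<chi> i j. v i $ J j) = mat 1" by (simp add: mat_def assms vec_eq_iff)
  then show ?thesis by (simp add: coord_wedge_def)
qed

lemma axis_nth_omit: "axis (omit k i) 1 $ omit k j = (if i = j then 1 else 0)"
  by (auto simp: axis_def inj_eq[OF inj_omit])

lemma sum_coord_wedge_single: "(\<Sum>J\<in>UNIV. (if J = J0 then c else 0) * coord_wedge J v) = c * coord_wedge J0 v"
  by (simp add: if_distrib[of "\<lambda>x. x * _"] cong: if_cong)

lemma card_coord: "CARD('n::finite coord) = Suc CARD('n option)"
proof -
  have "inj (case_option Cx Cz :: 'n option \<Rightarrow> 'n coord)"
    by (rule injI) (auto split: option.splits)
  moreover have "Cy \<notin> range (case_option Cx Cz :: 'n option \<Rightarrow> 'n coord)" by (auto split: option.splits)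
  ultimately show ?thesis unfolding UNIV_coord by (simp add: card_image)
qed

context X_variety
begin

text \<open>
  On tangent vectors at a point with nonzero gradient the description determines the value, by
  \<open>minor_relation\<close>. At the other regular points \<open>X\<close> is locally the hyperplane \<open>x = 0\<close>, and
  the form is \<open>dy \<and> dz\<close>.
\<close>
definition residue_form :: "('n coord, 'n option) form" where
  "residue_form p v = (if \<exists>k. grad p k \<noteq> 0 then THE l. \<forall>k. minor k v = grad p k * l
     else coord_wedge (omit Cx) v)"

lemma residue_form_eq:
  assumes v: "\<And>m. v m \<in> tangent_vectors X p" and k: "grad p k \<noteq> 0"
  shows "residue_form p v = minor k v / grad p k"
proof -
  have rel: "grad p k * minor l v = grad p l * minor k v" for l
    by (rule minor_relation) (rule grad_tangent[OF v])
  have "(THE l. \<forall>k. minor k v = grad p k * l) = minor k v / grad p k"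
  proof (rule the_equality)
    show "\<forall>l. minor l v = grad p l * (minor k v / grad p k)"
      using rel k by (simp add: field_simps)
  qed (use k in \<open>simp add: field_simps\<close>)
  then show ?thesis using k unfolding residue_form_def by auto
qed

text \<open>
  If the gradient is 0 at \<open>p\<close>, then it is 0 on \<open>X\<close> near \<open>p\<close>. Its \<open>y\<close>-component is \<open>x^2\<close>, so
  \<open>x = 0\<close> on \<open>X\<close> near \<open>p\<close>.
\<close>
lemma regular_cases:
  assumes p: "regular_at CARD('n option) X p"
  obtains k where "grad p k \<noteq> 0"
  | W where "open W" "p \<in> W" "\<And>q. q \<in> W \<Longrightarrow> q \<in> X \<longleftrightarrow> q $ Cx = 0" "\<And>q k. q \<in> X \<inter> W \<Longrightarrow> grad q k = 0"
proof (cases "\<exists>k. grad p k \<noteq> 0")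
  case False
  then have sing: "dir_deriv f v p = 0" for v using dir_deriv_sum[OF hol_eqn, of p v] by simp
  from p obtain U V \<phi> \<psi> I where c: "flat_chart X U V \<phi> \<psi> I" and pU: "p \<in> X \<inter> U" and I: "card I = CARD('n option)"
    by (rule regular_atE)
  interpret flat_chart X U V \<phi> \<psi> I by (rule c)
  have "\<exists>W. open W \<and> p \<in> W \<and> (\<forall>q\<in>X \<inter> W. \<forall>v. dir_deriv f v q = 0)"
    by (rule gradient_vanishes_nearby[OF _ pU hol_eqn _ sing]) (use I in \<open>simp_all add: card_coord X_var_iff\<close>)
  then obtain W where W: "open W" "p \<in> W" "\<And>q v. q \<in> X \<inter> W \<Longrightarrow> dir_deriv f v q = 0"
    by auto
  have x0: "q $ Cx = 0" if "q \<in> X \<inter> W" for q using W(3)[OF that, of "axis Cy 1"] grad_Cy[of q] by simp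
  have "W \<inter> {q \<in> X. q $ Cx \<noteq> 0} = {}" using x0 by auto
  then have "p \<notin> closure {q \<in> X. q $ Cx \<noteq> 0}"
    using W(1,2) open_Int_closure_eq_empty by blast
  moreover have "p \<in> X" "p $ Cx = 0" using pU W(2) x0 by auto
  ultimately obtain W' where W': "open W'" "p \<in> W'" "\<And>q. q \<in> W' \<Longrightarrow> q \<in> X \<longleftrightarrow> q $ Cx = 0"
    using locally_x_eq_0[of p] by metis
  show ?thesis
    by (rule that(2)[of "W \<inter> W'"]) (use W W' in auto)
qed blast

lemma holomorphic_form_residue_form: "holomorphic_form X residue_form"
  unfolding holomorphic_form_def regular_part_def
proof (intro ballI)
  fix p assume "p \<in> {p. regular_at CARD('n option) X p}"
  then have "regular_at CARD('n option) X p" by simp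
  then show "\<exists>U c. open U \<and> p \<in> U \<and> (\<forall>J :: 'n option \<Rightarrow> 'n coord. hol_fun_on U (c J)) \<and>
        (\<forall>q\<in>{p. regular_at CARD('n option) X p} \<inter> U. \<forall>v. (\<forall>k. v k \<in> tangent_vectors X q) \<longrightarrow>
           residue_form q v = (\<Sum>J\<in>UNIV. c J q * coord_wedge J v))"
  proof (cases rule: regular_cases)
    case (1 k)
    define U where "U = {q. grad q k \<noteq> 0}"
    have hg: "hol_fun_on UNIV (\<lambda>q. grad q k)" by (rule hol_fun_on_dir_deriv[OF open_UNIV hol_eqn])
    define c where "c = (\<lambda>J q. if J = omit k then (if k = Cy then 1 else -1) / grad q k else 0)"
    have "open U" unfolding U_def
      using hol_fun_on_continuous_on[OF hg] by (intro open_Collect_neq) auto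
    moreover have "hol_fun_on U (c J)" for J
      unfolding c_def using hol_fun_on_subset[OF hg, of U]
      by (cases "J = omit k") (auto simp: U_def intro!: hol_fun_intros)
    moreover have "residue_form q v = (\<Sum>J\<in>UNIV. c J q * coord_wedge J v)"
      if "q \<in> U" "\<And>m. v m \<in> tangent_vectors X q" for q v
      using residue_form_eq[OF that(2), of k] that(1)
      by (simp add: c_def sum_coord_wedge_single U_def minor_def)
    ultimately show ?thesis using 1 by (intro exI[of _ U] exI[of _ c]) (auto simp: U_def)
  next
    case (2 W)
    define c :: "('n option \<Rightarrow> 'n coord) \<Rightarrow> complex^('n coord) \<Rightarrow> complex"
      where "c = (\<lambda>J q. if J = omit Cx then 1 else 0)"
    have "hol_fun_on W (c J)" for J
      unfolding c_def by (cases "J = omit Cx") (auto intro!: hol_fun_intros)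
    moreover have "residue_form q v = (\<Sum>J\<in>UNIV. c J q * coord_wedge J v)" if "q \<in> W" "q \<in> X" for q v
      using 2(4)[of q] that by (simp add: c_def sum_coord_wedge_single residue_form_def)
    ultimately show ?thesis using 2 by (intro exI[of _ W] exI[of _ c]) (auto simp: regular_at_def)
  qed
qed

text \<open>
  In both cases of \<open>regular_cases\<close> the tangent space contains vectors dual to the coordinates
  in question, on which the corresponding minor is 1.
\<close>
lemma residue_form_nonzero:
  assumes p: "regular_at CARD('n option) X p"
  shows "\<exists>v. (\<forall>m. v m \<in> tangent_vectors X p) \<and> residue_form p v \<noteq> 0"
  using p
proof (cases rule: regular_cases)
  case (1 k)
  from p obtain U V \<phi> \<psi> I where c: "flat_chart X U V \<phi> \<psi> I" and pU: "p \<in> X \<inter> U" and I: "card I = CARD('n option)"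
    by (rule regular_atE)
  interpret flat_chart X U V \<phi> \<psi> I by (rule c)
  have T: "tangent_vectors X p = {v. dir_deriv f v p = 0}"
    using tangent_vectors_eq_kernel[OF _ pU open_UNIV hol_eqn _ _ 1] I by (auto simp: card_coord X_var_iff)
  define v where "v = (\<lambda>m :: 'n option. axis (omit k m) 1 + (- grad p (omit k m) / grad p k) *s axis k (1::complex))"
  have "v m \<in> tangent_vectors X p" for m
  proof -
    interpret linear "\<lambda>v. dir_deriv f v p" by (rule hol_fun_on_has_derivative(3)[OF hol_eqn]) simp
    show ?thesis
      using 1 by (simp add: T v_def add diff hol_fun_on_has_derivative(2)[OF hol_eqn])
  qed
  moreover have "coord_wedge (omit k) v = 1"
    by (rule coord_wedge_dual) (use omit_neq[of k] in \<open>simp add: v_def axis_nth_omit axis_def[of k]\<close>)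
  ultimately show ?thesis using residue_form_eq[of v p k] 1 
    by (intro exI[of _ v]) (auto simp: minor_def)
next
  case (2 W)
  define v where "v = (\<lambda>m :: 'n option. axis (omit Cx m) (1::complex))"
  have pX: "p \<in> X" using p by (simp add: regular_at_def)
  have "v m \<in> tangent_vectors X p" for m
  proof (rule tangent_vectorsI[of "(\<lambda>t. p + t *s v m) -` W" "\<lambda>t. p + t *s v m"])
    show "open ((\<lambda>t. p + t *s v m) -` W)" by (intro open_vimage 2 continuous_intros)
    show "v m = (\<chi> i. deriv (\<lambda>t. (p + t *s v m) $ i) 0)"
      by (auto simp: vec_eq_iff intro!: DERIV_imp_deriv[symmetric] derivative_eq_intros)
    show "p + t *s v m \<in> X" if "t \<in> (\<lambda>t. p + t *s v m) -` W" for t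
      using that 2(2) 2(3)[of p] 2(3)[of "p + t *s v m"] pX omit_neq[of Cx m] by (simp add: v_def axis_def)
  qed (use 2(2) in \<open>auto intro!: holomorphic_intros\<close>)
  moreover have "coord_wedge (omit Cx) v = 1"
    by (rule coord_wedge_dual) (simp add: v_def axis_nth_omit)
  ultimately show ?thesis using 2(4)[of p] 2(2) pX
    by (intro exI[of _ v]) (auto simp: residue_form_def)
qed

lemma is_omega_residue_form: "is_omega X residue_form"
  unfolding is_omega_def holomorphic_volume_form_def
proof (intro conjI ballI impI allI holomorphic_form_residue_form)
  fix p assume "p \<in> regular_part CARD('n option) X"
  then show "\<exists>v. (\<forall>m. v m \<in> tangent_vectors X p) \<and> residue_form p v \<noteq> 0"
    by (intro residue_form_nonzero) (simp add: regular_part_def)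
next
  fix p :: "complex^('n coord)" and v :: "'n option \<Rightarrow> complex^('n coord)"
  assume "p $ Cx \<noteq> 0" "\<forall>k. v k \<in> tangent_vectors X p"
  then show "residue_form p v = coord_wedge (case_option Cx Cz) v / (p $ Cx)\<^sup>2"
    using residue_form_eq[of v p Cy] by (simp add: grad_Cy minor_def omit_Cy)
qed

end

section \<open>Ambient automorphisms preserving a form\<close>

text \<open>
  Restrictions of ambient biholomorphisms, with the derivative of the extension in place of
  \<open>differential\<close>. In contrast to abstract automorphisms of \<open>X\<close>, their composition and their
  effect on charts are immediate.
\<close>
definition ambient_volume_maps :: "(complex^'m) set \<Rightarrow> ('m::finite, 'k::finite) form \<Rightarrow> (complex^'m \<Rightarrow> complex^'m) set" where
  "ambient_volume_maps X \<omega> = {G. (\<exists>H. hol_map_on UNIV G \<and> hol_map_on UNIV H \<and> (\<forall>q. H (G q) = q) \<and> (\<forall>q. G (H q) = q)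
      \<and> G ` X = X) \<and> (\<forall>p\<in>regular_part CARD('k) X. \<forall>v. (\<forall>k. v k \<in> tangent_vectors X p) \<longrightarrow>
          \<omega> (G p) (\<lambda>k. jac G (v k) p) = \<omega> p v)}"

lemma ambient_volume_maps_subset:
  fixes \<omega> :: "('m::finite, 'k::finite) form"
  shows "ambient_volume_maps X \<omega> \<subseteq> volume_group X \<omega>"
proof
  fix G assume "G \<in> ambient_volume_maps X \<omega>"
  then obtain H where G: "hol_map_on UNIV G" "hol_map_on UNIV H" "\<And>q. H (G q) = q" "\<And>q. G (H q) = q" "G ` X = X"
    and pres: "\<And>p v. p \<in> regular_part CARD('k) X \<Longrightarrow> (\<And>k. v k \<in> tangent_vectors X p) \<Longrightarrow>
          \<omega> (G p) (\<lambda>k. jac G (v k) p) = \<omega> p v"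
    unfolding ambient_volume_maps_def by auto
  have inj: "inj G" by (rule inj_on_inverseI[of _ H]) (use G in simp)
  have "G \<in> Aut X"
    unfolding Aut_def hol_map_variety_def local_extension_def
  proof (intro CollectI conjI ballI)
    show bij: "bij_betw G X X" using inj G(5) by (auto simp: bij_betw_def intro: inj_on_subset)
    fix p assume "p \<in> X"
    show "\<exists>U Ga. open U \<and> p \<in> U \<and> hol_map_on U Ga \<and> (\<forall>q\<in>X \<inter> U. G q = Ga q)"
      using G(1) by (intro exI[of _ UNIV] exI[of _ G]) simp
    have "inv_into X G q = H q" if "q \<in> X" for q
    proof -
      have "q \<in> G ` X" using G(5) that by simp
      then obtain x where "x \<in> X" "q = G x" by auto
      then show ?thesis using bij_betw_inv_into_left[OF bij] G(3) by simp
    qed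
    then show "\<exists>U Ga. open U \<and> p \<in> U \<and> hol_map_on U Ga \<and> (\<forall>q\<in>X \<inter> U. inv_into X G q = Ga q)"
      using G(2) by (intro exI[of _ UNIV] exI[of _ H]) simp
  qed
  moreover have "pullback X G \<omega> p v = \<omega> p v"
    if "p \<in> regular_part CARD('k) X" "\<And>k. v k \<in> tangent_vectors X p" for p v
    using pres[OF that] differential_eq_jac[OF open_UNIV G(1) UNIV_I refl that(2)] by (simp add: pullback_def)
  ultimately show "G \<in> volume_group X \<omega>" unfolding volume_group_def by blast
qed

lemma ambient_volume_maps_compose:
  assumes "F \<in> ambient_volume_maps X (\<omega> :: ('m::finite, 'k::finite) form)" "G \<in> ambient_volume_maps X \<omega>"
  shows "(\<lambda>p. F (G p)) \<in> ambient_volume_maps X \<omega>"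
proof -
  obtain F' where F: "hol_map_on UNIV F" "hol_map_on UNIV F'" "\<And>q. F' (F q) = q" "\<And>q. F (F' q) = q" "F ` X = X"
    and Fpres: "\<And>p v. p \<in> regular_part CARD('k) X \<Longrightarrow> (\<And>k. v k \<in> tangent_vectors X p) \<Longrightarrow>
          \<omega> (F p) (\<lambda>k. jac F (v k) p) = \<omega> p v"
    using assms(1) unfolding ambient_volume_maps_def by auto
  obtain G' where G: "hol_map_on UNIV G" "hol_map_on UNIV G'" "\<And>q. G' (G q) = q" "\<And>q. G (G' q) = q" "G ` X = X"
    and Gpres: "\<And>p v. p \<in> regular_part CARD('k) X \<Longrightarrow> (\<And>k. v k \<in> tangent_vectors X p) \<Longrightarrow>
          \<omega> (G p) (\<lambda>k. jac G (v k) p) = \<omega> p v"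
    using assms(2) unfolding ambient_volume_maps_def by auto
  have "hol_map_on UNIV (\<lambda>p. F (G p))" "hol_map_on UNIV (\<lambda>p. G' (F' p))"
    using F G by (auto intro: hol_map_on_compose)
  moreover have "(\<lambda>p. F (G p)) ` X = X" using F(5) G(5) by (metis image_image)
  moreover have "\<omega> (F (G p)) (\<lambda>k. jac (\<lambda>p. F (G p)) (v k) p) = \<omega> p v"
    if p: "p \<in> regular_part CARD('k) X" and v: "\<And>k. v k \<in> tangent_vectors X p" for p v
  proof -
    have "G p \<in> regular_part CARD('k) X"
      using regular_at_image[OF G] p by (simp add: regular_part_def)
    moreover have "jac G (v k) p \<in> tangent_vectors X (G p)" for k
      using G(5) by (intro tangent_vectors_image[OF v open_UNIV G(1)]) auto
    ultimately have "\<omega> (F (G p)) (\<lambda>k. jac F (jac G (v k) p) (G p)) = \<omega> p v"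
      using Fpres[of "G p" "\<lambda>k. jac G (v k) p"] Gpres[OF p v] by simp
    then show ?thesis using jac_compose[OF G(1) UNIV_I F(1) UNIV_I] by simp
  qed
  ultimately show ?thesis
    unfolding ambient_volume_maps_def using F(3,4) G(3,4)
    by (intro CollectI conjI exI[of _ "\<lambda>p. G' (F' p)"]) auto
qed

lemma continuous_on_coord_wedge:
  assumes "\<And>k. continuous_on S (w k)"
  shows "continuous_on S (\<lambda>q. coord_wedge J (\<lambda>k. w k q))"
  unfolding coord_wedge_def det_def by (intro continuous_intros) (use assms in \<open>auto intro!: continuous_intros\<close>)

text \<open>
  Extend the tangent vectors \<open>v k\<close> to continuous tangent fields \<open>N k\<close> near \<open>p\<close>. The difference
  \<open>R\<close> of the two forms on these fields is continuous on an ambient neighbourhood, since both forms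
  have holomorphic coefficients there, and it vanishes on \<open>T\<close>.
\<close>
lemma pullback_eq_by_continuity:
  fixes \<omega> :: "('m::finite, 'k::finite) form"
  assumes \<omega>: "holomorphic_form X \<omega>" and G: "hol_map_on UNIV G" and p: "p \<in> regular_part CARD('k) X"
    and Greg: "\<And>q. q \<in> regular_part CARD('k) X \<Longrightarrow> G q \<in> regular_part CARD('k) X"
    and GX: "G ` X \<subseteq> X"
    and cl: "p \<in> closure T" "T \<subseteq> X"
    and eq: "\<And>q v. q \<in> regular_part CARD('k) X \<inter> T \<Longrightarrow> (\<And>k. v k \<in> tangent_vectors X q) \<Longrightarrow> \<omega> (G q) (\<lambda>k. jac G (v k) q) = \<omega> q v"
    and v: "\<And>k. v k \<in> tangent_vectors X p"
  shows "\<omega> (G p) (\<lambda>k. jac G (v k) p) = \<omega> p v"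
proof -
  obtain U V \<phi> \<psi> I where c: "flat_chart X U V \<phi> \<psi> I" and pU: "p \<in> X \<inter> U" and I: "card I = CARD('k)"
    using p by (auto simp: regular_part_def elim: regular_atE)
  interpret flat_chart X U V \<phi> \<psi> I by (rule c)
  have reg: "q \<in> regular_part CARD('k) X" if "q \<in> X \<inter> U" for q
    using regular[OF that] I by (simp add: regular_part_def)
  have "\<exists>N. N p = v k \<and> continuous_on U N \<and> (\<forall>q\<in>X \<inter> U. N q \<in> tangent_vectors X q)" for k
    using extend_tangent_vector[OF v[of k]] pU by (metis IntD2)
  then obtain N where N: "\<And>k. N k p = v k" "\<And>k. continuous_on U (N k)" "\<And>k q. q \<in> X \<inter> U \<Longrightarrow> N k q \<in> tangent_vectors X q"
    by metis
  obtain U1 c1 where 1: "open U1" "p \<in> U1" "\<And>J :: 'k \<Rightarrow> 'm. hol_fun_on U1 (c1 J)"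
    "\<And>q v. q \<in> regular_part CARD('k) X \<inter> U1 \<Longrightarrow> (\<And>k. v k \<in> tangent_vectors X q) \<Longrightarrow>
         \<omega> q v = (\<Sum>J\<in>UNIV. c1 J q * coord_wedge J v)"
    using bspec[OF \<omega>[unfolded holomorphic_form_def] p] by (elim exE conjE) blast
  obtain U2 c2 where 2: "open U2" "G p \<in> U2" "\<And>J :: 'k \<Rightarrow> 'm. hol_fun_on U2 (c2 J)"
    "\<And>q v. q \<in> regular_part CARD('k) X \<inter> U2 \<Longrightarrow> (\<And>k. v k \<in> tangent_vectors X q) \<Longrightarrow>
         \<omega> q v = (\<Sum>J\<in>UNIV. c2 J q * coord_wedge J v)"
    using bspec[OF \<omega>[unfolded holomorphic_form_def] Greg[OF p]] by (elim exE conjE) blast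
  have contG: "continuous_on A G" for A
    using hol_map_on_continuous_on[OF G] by (rule continuous_on_subset) simp
  define S where "S = U \<inter> U1 \<inter> G -` U2"
  have S: "open S" "p \<in> S" "S \<subseteq> U" "S \<subseteq> U1" "G ` S \<subseteq> U2"
    using open_U 1(1,2) 2(1,2) pU contG by (auto simp: S_def intro!: open_Int open_vimage)
  have GN: "jac G (N k q) q \<in> tangent_vectors X (G q)" if "q \<in> X \<inter> U" for k q
    using GX by (intro tangent_vectors_image[OF N(3)[OF that] open_UNIV G]) auto
  define R where "R = (\<lambda>q. (\<Sum>J\<in>UNIV. c2 J (G q) * coord_wedge J (\<lambda>k. jac G (N k q) q))
       - (\<Sum>J\<in>UNIV. c1 J q * coord_wedge J (\<lambda>k. N k q)))"
  have R: "R q = \<omega> (G q) (\<lambda>k. jac G (N k q) q) - \<omega> q (\<lambda>k. N k q)" if "q \<in> X \<inter> S" for q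
  proof -
    have q: "q \<in> X \<inter> U" "q \<in> U1" "G q \<in> U2" using that S by auto
    show ?thesis unfolding R_def
      using 1(4)[of q "\<lambda>k. N k q"] 2(4)[of "G q" "\<lambda>k. jac G (N k q) q"] reg[OF q(1)] Greg[OF reg[OF q(1)]] q N(3)[OF q(1)] GN[OF q(1)]
      by simp
  qed
  have "continuous_on S R"
    unfolding R_def
  proof (intro continuous_intros continuous_on_coord_wedge)
    fix J :: "'k \<Rightarrow> 'm" and k
    show "continuous_on S (\<lambda>q. c2 J (G q))"
      by (rule continuous_on_compose2[OF hol_fun_on_continuous_on[OF 2(3)] contG S(5)])
    show "continuous_on S (c1 J)" using hol_fun_on_continuous_on[OF 1(3)] S(4) by (rule continuous_on_subset)
    show NS: "continuous_on S (\<lambda>q. N k q)" using N(2) S(3) by (rule continuous_on_subset)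
    show "continuous_on S (\<lambda>q. jac G (N k q) q)"
      by (rule continuous_on_jac[OF open_UNIV G continuous_on_id NS]) simp
  qed
  then have "isCont R p" using S by (simp add: continuous_on_eq_continuous_at)
  have "R p = 0"
  proof (rule ccontr)
    assume "R p \<noteq> 0"
    have "(R \<longlongrightarrow> R p) (nhds p)"
      using \<open>isCont R p\<close> unfolding isCont_def tendsto_at_iff_tendsto_nhds .
    then have "\<forall>\<^sub>F q in nhds p. R q \<noteq> 0" using \<open>R p \<noteq> 0\<close> by (rule tendsto_imp_eventually_ne)
    then have "\<forall>\<^sub>F q in nhds p. R q \<noteq> 0 \<and> q \<in> S"
      using S by (intro eventually_conj eventually_nhds_in_open)
    then obtain M where M: "open M" "p \<in> M" "\<And>q. q \<in> M \<Longrightarrow> R q \<noteq> 0 \<and> q \<in> S"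
      unfolding eventually_nhds by blast
    then obtain q where q: "q \<in> M" "q \<in> T" using cl(1) open_Int_closure_eq_empty[of M T] by blast
    then have qS: "q \<in> X \<inter> S" "q \<in> X \<inter> U" using M(3) cl(2) S(3) by auto
    have "R q = 0" using R[OF qS(1)] eq[of q "\<lambda>k. N k q"] reg[OF qS(2)] q(2) N(3)[OF qS(2)] by simp
    then show False using M(3) q by simp
  qed
  then show ?thesis using R[of p] pU S(2) by (simp add: N(1))
qed

section \<open>Shears\<close>

lemma diff_quotient_increment: "f (z + t *s v) = f z + t * diff_quotient f v z t"
  by (simp add: diff_quotient_def)

lemma diff_quotient_reverse: "diff_quotient f v (z + t *s v) (- t) = diff_quotient f v z t"
  by (auto simp: diff_quotient_def divide_simps)

context X_variety
begin

text \<open>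
  Over the point \<open>x\<close> the shear moves \<open>z\<close> along \<open>e_i\<close> by \<open>x^2 g(z j)\<close>. This changes
  \<open>a(z) + x b(z)\<close> by this amount times a difference quotient; division by \<open>x^2\<close>
  leaves the change of \<open>y\<close> in the definition of \<open>shear\<close>, which is holomorphic across \<open>x = 0\<close>.
\<close>
definition shear_time :: "'n \<Rightarrow> (complex \<Rightarrow> complex) \<Rightarrow> complex^('n coord) \<Rightarrow> complex" where
  "shear_time j g p = (p $ Cx)\<^sup>2 * g (p $ Cz j)"

definition shear :: "'n \<Rightarrow> 'n \<Rightarrow> (complex \<Rightarrow> complex) \<Rightarrow> complex^('n coord) \<Rightarrow> complex^('n coord)" where
  "shear i j g p = (\<chi> c. case c of Cx \<Rightarrow> p $ Cx
     | Cy \<Rightarrow> p $ Cy + g (p $ Cz j) * (diff_quotient a (axis i 1) (coord_z p) (shear_time j g p)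
          + p $ Cx * diff_quotient b (axis i 1) (coord_z p) (shear_time j g p))
     | Cz l \<Rightarrow> p $ Cz l + (if l = i then shear_time j g p else 0))"

lemma shear_nth [simp]:
  "shear i j g p $ Cx = p $ Cx"
  "shear i j g p $ Cz l = p $ Cz l + (if l = i then shear_time j g p else 0)"
  by (simp_all add: shear_def)

lemma coord_z_shear: "coord_z (shear i j g p) = coord_z p + shear_time j g p *s axis i 1"
  by (simp add: vec_eq_iff axis_def)

lemma eqn_shear: "f (shear i j g p) = f p"
  unfolding eqn_def coord_z_shear diff_quotient_increment
  by (simp add: shear_def shear_time_def algebra_simps power2_eq_square)

lemma shear_inverse: assumes "i \<noteq> j" shows "shear i j (\<lambda>z. - g z) (shear i j g p) = p"
proof -
  have t: "shear_time j (\<lambda>z. - g z) (shear i j g p) = - shear_time j g p"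
    using assms by (simp add: shear_time_def)
  have y: "shear i j g p $ Cy = p $ Cy + g (p $ Cz j) * (diff_quotient a (axis i 1) (coord_z p) (shear_time j g p)
          + p $ Cx * diff_quotient b (axis i 1) (coord_z p) (shear_time j g p))"
    by (simp add: shear_def)
  have "shear i j (\<lambda>z. - g z) (shear i j g p) $ c = p $ c" for c
  proof (cases c)
    case Cy
    show ?thesis unfolding Cy shear_def[of i j "\<lambda>z. - g z"] t coord_z_shear diff_quotient_reverse
      using assms by (simp add: y algebra_simps)
  qed (use t in auto)
  then show ?thesis by (simp add: vec_eq_iff)
qed

lemma shear_inverse': "i \<noteq> j \<Longrightarrow> shear i j g (shear i j (\<lambda>z. - g z) p) = p"
  using shear_inverse[of i j "\<lambda>z. - g z" p] by simp

lemma hol_shear_time: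
  assumes "g holomorphic_on UNIV"
  shows "hol_fun_on UNIV (shear_time j g)"
  unfolding shear_time_def[abs_def]
  by (intro hol_fun_intros hol_fun_on_compose_entire[OF hol_fun_on_nth])
    (use assms in \<open>simp add: holomorphic_on_open field_differentiable_def\<close>)

lemma hol_shear:
  assumes g: "g holomorphic_on UNIV"
  shows "hol_map_on UNIV (shear i j g)"
  unfolding hol_map_on_def
proof
  fix c
  have gz: "hol_fun_on UNIV (\<lambda>p. g (p $ Cz j))"
    by (intro hol_fun_on_compose_entire[OF hol_fun_on_nth])
      (use g in \<open>simp add: holomorphic_on_open field_differentiable_def\<close>)
  note t = hol_shear_time[OF g, of j]
  show "hol_fun_on UNIV (\<lambda>p. shear i j g p $ c)"
  proof (cases c)
    case Cy
    show ?thesis unfolding Cy shear_def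
      by (simp, intro hol_fun_intros gz hol_fun_on_diff_quotient a b hol_coord_z t)
  next
    case (Cz l)
    then show ?thesis by (cases "l = i") (auto intro!: hol_fun_intros t)
  qed (auto intro!: hol_fun_intros)
qed

lemma shear_image: "i \<noteq> j \<Longrightarrow> shear i j g ` X = X"
proof (intro antisym subsetI)
  fix q assume "i \<noteq> j" "q \<in> X"
  then show "q \<in> shear i j g ` X"
    by (intro image_eqI[of _ _ "shear i j (\<lambda>z. - g z) q"]) (auto simp: shear_inverse' X_var_iff eqn_shear)
qed (auto simp: X_var_iff eqn_shear)

text \<open>
  The shear adds to \<open>dz i\<close> a combination of \<open>dx\<close> and \<open>dz j\<close>, a row operation.
\<close>
lemma coord_wedge_shear:
  assumes g: "g holomorphic_on UNIV" and "i \<noteq> j"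
  shows "coord_wedge (case_option Cx Cz) (\<lambda>k. jac (shear i j g) (v k) p) = coord_wedge (case_option Cx Cz) v"
proof -
  note t = hol_shear_time[OF g, of j]
  define R where "R = (\<lambda>c. \<chi> k. v k $ c)"
  define A where "A = (\<chi> m. R (case_option Cx Cz m))"
  define \<alpha> where "\<alpha> = dir_deriv (shear_time j g) (axis Cx 1) p"
  define \<beta> where "\<beta> = dir_deriv (shear_time j g) (axis (Cz j) 1) p"
  have dt: "dir_deriv (shear_time j g) w p = \<alpha> * w $ Cx + \<beta> * w $ Cz j" for w
  proof -
    have "dir_deriv (shear_time j g) (axis c 1) p = 0" if "c \<noteq> Cx" "c \<noteq> Cz j" for c
    proof -
      have "shear_time j g (p + s *s axis c 1) = shear_time j g p" for s
        using that by (simp add: shear_time_def axis_def)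
      then show ?thesis by (simp add: dir_deriv_def)
    qed
    then have "dir_deriv (shear_time j g) w p = (\<Sum>c\<in>{Cx, Cz j}. w $ c * dir_deriv (shear_time j g) (axis c 1) p)"
      unfolding dir_deriv_sum[OF t UNIV_I, of w] by (intro sum.mono_neutral_right) auto
    then show ?thesis by (simp add: \<alpha>_def \<beta>_def mult.commute)
  qed
  have jx: "jac (shear i j g) w p $ Cx = w $ Cx" for w
    by (simp add: jac_def dir_deriv_nth)
  have jz: "jac (shear i j g) w p $ Cz l = w $ Cz l + (if l = i then \<alpha> * w $ Cx + \<beta> * w $ Cz j else 0)" for w l
  proof (cases "l = i")
    case True
    have "dir_deriv (\<lambda>q. q $ Cz i + shear_time j g q) w p = w $ Cz i + dir_deriv (shear_time j g) w p"
      by (rule dir_deriv_eqI)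
        (auto intro!: derivative_eq_intros hol_fun_on_has_derivative(1)[OF t]
           bounded_linear_imp_has_derivative bounded_linear_vec_nth 
          simp: hol_fun_on_has_derivative(2)[OF t] algebra_simps)
    then show ?thesis using True by (simp add: jac_def dt)
  qed (simp add: jac_def dir_deriv_nth)
  have "(\<chi> m. \<chi> k. jac (shear i j g) (v k) p $ case_option Cx Cz m) =
     (\<chi> m. if m = Some i then row (Some i) A + (\<alpha> *s R Cx + \<beta> *s R (Cz j)) else row m A)"
    by (auto simp: vec_eq_iff row_def A_def R_def jx jz split: option.split)
  also have "det \<dots> = det A"
  proof (rule det_row_span)
    have "row None A = R Cx" "row (Some j) A = R (Cz j)" by (simp_all add: row_def A_def vec_eq_iff)
    then have "R Cx \<in> {row m A |m. m \<noteq> Some i}" "R (Cz j) \<in> {row m A |m. m \<noteq> Some i}"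
      using \<open>i \<noteq> j\<close> by (force intro: exI[of _ None] exI[of _ "Some j"])+
    then show "\<alpha> *s R Cx + \<beta> *s R (Cz j) \<in> vec.span {row m A |m. m \<noteq> Some i}"
      by (intro vec.span_add vec.span_scale vec.span_base)
  qed
  finally show ?thesis by (simp add: coord_wedge_rows A_def R_def)
qed

text \<open>
  For \<open>x \<noteq> 0\<close> the form is given by \<open>dx \<and> dz / x^2\<close>, and continuity reaches the limits of such
  points. At the remaining regular points \<open>\<omega>\<close> may be any volume form, but \<open>a\<close> vanishes nearby
  and \<open>x = 0\<close>, so the shear is the identity on \<open>X\<close> there.
\<close>
lemma shear_preserves_omega:
  assumes \<omega>: "is_omega X \<omega>" and g: "g holomorphic_on UNIV" and ij: "i \<noteq> j"
  shows "shear i j g \<in> ambient_volume_maps X \<omega>"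
proof -
  define G where "G = shear i j g"
  have G: "hol_map_on UNIV G" "hol_map_on UNIV (shear i j (\<lambda>z. - g z))" "\<And>q. shear i j (\<lambda>z. - g z) (G q) = q"
    "\<And>q. G (shear i j (\<lambda>z. - g z) q) = q" "G ` X = X"
    unfolding G_def using g ij
    by (simp_all add: hol_shear shear_inverse shear_inverse' shear_image holomorphic_on_minus)
  have reg: "G q \<in> regular_part CARD('n option) X" if "q \<in> regular_part CARD('n option) X" for q
    using regular_at_image[OF G] that by (simp add: regular_part_def)
  have tang: "jac G v q \<in> tangent_vectors X (G q)" if "v \<in> tangent_vectors X q" for q v
    using G(5) by (intro tangent_vectors_image[OF that open_UNIV G(1)]) auto
  have off: "\<omega> (G q) (\<lambda>k. jac G (v k) q) = \<omega> q v"
    if q: "q \<in> regular_part CARD('n option) X" "q $ Cx \<noteq> 0" and v: "\<And>k. v k \<in> tangent_vectors X q" for q v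
  proof -
    have *: "\<omega> q v = coord_wedge (case_option Cx Cz) v / (q $ Cx)\<^sup>2"
      if "q \<in> regular_part CARD('n option) X" "q $ Cx \<noteq> 0" "\<And>k. v k \<in> tangent_vectors X q" for q v
      using \<omega> that unfolding is_omega_def by blast
    have x: "G q $ Cx = q $ Cx" by (simp add: G_def)
    show ?thesis
      using *[OF q v] *[of "G q" "\<lambda>k. jac G (v k) q"] reg[OF q(1)] tang[OF v] q(2) x coord_wedge_shear[OF g ij, of v q]
      by (simp add: G_def)
  qed
  have pres: "\<omega> (G p) (\<lambda>k. jac G (v k) p) = \<omega> p v"
    if p: "p \<in> regular_part CARD('n option) X" and v: "\<And>k. v k \<in> tangent_vectors X p" for p v
  proof -
    have pX: "p \<in> X" using p by (simp add: regular_part_def regular_at_def)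
    consider "p $ Cx \<noteq> 0" | "p \<in> closure {q \<in> X. q $ Cx \<noteq> 0}" | "p $ Cx = 0" "p \<notin> closure {q \<in> X. q $ Cx \<noteq> 0}"
      by blast
    then show ?thesis
    proof cases
      case 1 then show ?thesis using off p v by blast
    next
      case 2
      show ?thesis
      proof (rule pullback_eq_by_continuity[OF _ G(1) p reg _ 2 _ _ v])
        show "holomorphic_form X \<omega>" using \<omega> by (simp add: is_omega_def holomorphic_volume_form_def)
      qed (use off G(5) in auto)
    next
      case 3
      obtain W where W: "open W" "p \<in> W" "\<And>q. q \<in> W \<Longrightarrow> q \<in> X \<longleftrightarrow> q $ Cx = 0"
        "\<And>q. q \<in> W \<Longrightarrow> \<forall>\<^sub>F z in nhds (coord_z q). a z = 0"
        by (rule locally_x_eq_0[OF pX 3]) blast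
      have id: "G q = q" if "q \<in> X \<inter> W" for q
      proof -
        have x: "q $ Cx = 0" using W(3) that by blast
        have "dir_deriv a (axis i 1) (coord_z q) = dir_deriv (\<lambda>_. 0) (axis i 1) (coord_z q)"
          using W(4) that by (intro dir_deriv_cong) auto
        then have "dir_deriv a (axis i 1) (coord_z q) = 0" by (simp add: dir_deriv_def)
        moreover have "shear_time j g q = 0" using x by (simp add: shear_time_def)
        ultimately have "G q $ c = q $ c" for c
          using x by (cases c) (simp_all add: G_def shear_def diff_quotient_def)
        then show ?thesis by (simp add: vec_eq_iff)
      qed
      have "jac G (v k) p = v k" for k
      proof -
        have "differential X G p (v k) = jac G (v k) p"
          by (rule differential_eq_jac[OF open_UNIV G(1) UNIV_I refl v])
        moreover have "differential X G p (v k) = jac (\<lambda>q. q) (v k) p"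
          by (rule differential_eq_jac[OF W(1) _ W(2) id v]) (auto simp: hol_map_on_def hol_fun_on_nth)
        ultimately show ?thesis by (simp add: jac_id)
      qed
      moreover have "G p = p" using id pX W(2) by blast
      ultimately show ?thesis by simp
    qed
  qed
  have "G \<in> ambient_volume_maps X \<omega>"
    unfolding ambient_volume_maps_def
    by (intro CollectI conjI exI[of _ "shear i j (\<lambda>z. - g z)"] ballI allI impI) (use G pres in auto)
  then show ?thesis by (simp add: G_def)
qed

section \<open>The tame sequence\<close>

definition tame_point :: "'n \<Rightarrow> nat \<Rightarrow> complex^('n coord)" where
  "tame_point i m = (\<chi> c. case c of Cx \<Rightarrow> 1 | Cy \<Rightarrow> a (axis i (of_nat m)) + b (axis i (of_nat m))
      | Cz l \<Rightarrow> axis i (of_nat m) $ l)"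

lemma tame_point_nth [simp]: "tame_point i m $ Cx = 1" "tame_point i m $ Cz l = axis i (of_nat m) $ l"
  by (simp_all add: tame_point_def)

lemma coord_z_tame_point: "coord_z (tame_point i m) = axis i (of_nat m)"
  by (simp add: vec_eq_iff)

lemma tame_point_in_X: "tame_point i m \<in> X"
  by (simp add: X_var_iff eqn_def coord_z_tame_point) (simp add: tame_point_def)

lemma eq_tame_point:
  assumes "q \<in> X" "q $ Cx = 1" "coord_z q = axis i (of_nat m)"
  shows "q = tame_point i m"
proof -
  have "q $ c = tame_point i m $ c" for c
  proof (cases c)
    case Cy
    have "f q = 0" using assms(1) by (simp add: X_var_iff)
    then show ?thesis unfolding Cy eqn_def assms(2,3) by (simp add: tame_point_def algebra_simps)
  next
    case (Cz l)
    then show ?thesis using assms(3) by (metis coord_z_nth tame_point_nth(2))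
  qed (use assms in simp)
  then show ?thesis by (simp add: vec_eq_iff)
qed

lemma dist_tame_point_ge: "dist (tame_point i m) (tame_point i m') \<ge> dist (of_nat m) (of_nat m' :: complex)"
  using Finite_Cartesian_Product.norm_nth_le[of "tame_point i m - tame_point i m'" "Cz i"] by (simp add: dist_norm)

text \<open>
  In the slice \<open>x = 1\<close> the coordinates \<open>(z i, z j)\<close> run through \<open>(m, 0)\<close>, \<open>(m, \<sigma> m)\<close>,
  \<open>(\<sigma> m, \<sigma> m)\<close> and \<open>(\<sigma> m, 0)\<close>. The second step must add \<open>\<sigma> m - m\<close> as a function of \<open>\<sigma> m\<close>
  alone; injectivity of \<open>\<sigma>\<close> makes this possible.
\<close>
lemma injection_extends:
  fixes \<sigma> :: "nat \<Rightarrow> nat"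
  assumes \<omega>: "is_omega X \<omega>" and ij: "i \<noteq> j" and \<sigma>: "inj \<sigma>"
  shows "\<exists>F\<in>volume_group X \<omega>. \<forall>m. F (tame_point i m) = tame_point i (\<sigma> m)"
proof -
  obtain g where g: "g holomorphic_on UNIV" "\<And>m. g (of_nat m) = of_nat (\<sigma> m)"
    using entire_interpolation_nat[of "\<lambda>m. of_nat (\<sigma> m)"] by blast
  \<comment> \<open>The function \<open>h\<close> is evaluated at \<open>\<sigma> m\<close> only, where \<open>inv \<sigma>\<close> gives back \<open>m\<close>.\<close>
  obtain h where h: "h holomorphic_on UNIV" "\<And>m. h (of_nat m) = of_nat m - of_nat (inv \<sigma> m)"
    using entire_interpolation_nat[of "\<lambda>m. of_nat m - of_nat (inv \<sigma> m)"] by blast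
  define F where "F = (\<lambda>p. shear j i (\<lambda>z. - z) (shear i j h (shear j i g p)))"
  note pres = shear_preserves_omega[OF \<omega>]
  have inner: "(\<lambda>p. shear i j h (shear j i g p)) \<in> ambient_volume_maps X \<omega>"
    by (rule ambient_volume_maps_compose[OF pres[OF h(1) ij] pres[OF g(1) ij[symmetric]]])
  have outer: "shear j i (\<lambda>z. - z) \<in> ambient_volume_maps X \<omega>"
    by (rule pres[OF _ ij[symmetric]]) (intro holomorphic_intros)
  have "F \<in> ambient_volume_maps X \<omega>"
    unfolding F_def by (rule ambient_volume_maps_compose[OF outer inner])
  moreover have "F (tame_point i m) = tame_point i (\<sigma> m)" for m
  proof (rule eq_tame_point)
    show "F (tame_point i m) \<in> X" using tame_point_in_X[of i m] by (simp add: F_def X_var_iff eqn_shear)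
    show "F (tame_point i m) $ Cx = 1" by (simp add: F_def)
    define p1 where "p1 = shear j i g (tame_point i m)"
    have 1: "p1 $ Cx = 1" "p1 $ Cz l = (if l = i then of_nat m else if l = j then of_nat (\<sigma> m) else 0)" for l
      using ij by (auto simp: p1_def shear_time_def g axis_def)
    define p2 where "p2 = shear i j h p1"
    have 2: "p2 $ Cx = 1" "p2 $ Cz l = (if l = i \<or> l = j then of_nat (\<sigma> m) else 0)" for l
      using ij \<sigma> by (auto simp: p2_def shear_time_def 1 h)
    show "coord_z (F (tame_point i m)) = axis i (of_nat (\<sigma> m))"
      unfolding F_def p1_def[symmetric] p2_def[symmetric]
      using ij by (auto simp: vec_eq_iff shear_time_def 2 axis_def)
  qed
  ultimately show ?thesis using ambient_volume_maps_subset by blast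
qed

lemma very_tame_range_tame_point:
  assumes \<omega>: "is_omega X \<omega>" and ij: "i \<noteq> j"
  shows "very_tame X \<omega> (range (tame_point i))"
proof -
  have sep: "m = m'" if "dist (tame_point i m) (tame_point i m') < 1" for m m'
  proof -
    have "(of_nat m - of_nat m' :: complex) = of_int (int m - int m')" by simp
    moreover have "norm (of_nat m - of_nat m' :: complex) < 1"
      using dist_tame_point_ge[of m m' i] that by (simp add: dist_norm)
    ultimately have "real_of_int \<bar>int m - int m'\<bar> < 1" by (simp only: norm_of_int of_int_abs)
    then show ?thesis by linarith
  qed
  then have inj: "inj (tame_point i)" by (metis dist_self injI zero_less_one)
  have "closed (range (tame_point i))"
    by (rule discrete_imp_closed[of 1]) (use sep in \<open>auto simp: dist_norm\<close>)
  then have "closedin (top_of_set X) (range (tame_point i))"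
    using tame_point_in_X by (intro closed_subset) auto
  moreover have "discrete (range (tame_point i))"
    by (rule discreteI) (use sep in \<open>auto simp: isolated_in_dist_Ex_iff intro!: exI[of _ 1]\<close>)
  moreover have "infinite (range (tame_point i))" using inj by (simp add: finite_image_iff)
  moreover have "\<exists>F\<in>volume_group X \<omega>. \<forall>p\<in>range (tame_point i). F p = f' p"
    if f': "f' ` range (tame_point i) \<subseteq> range (tame_point i)" "inj_on f' (range (tame_point i))" for f'
  proof -
    have "\<forall>m. \<exists>m'. f' (tame_point i m) = tame_point i m'" using f'(1) by blast
    then obtain \<sigma> where \<sigma>: "\<And>m. f' (tame_point i m) = tame_point i (\<sigma> m)" by metis
    have "inj \<sigma>"
    proof (rule injI)
      fix m m' assume "\<sigma> m = \<sigma> m'"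
      then have "f' (tame_point i m) = f' (tame_point i m')" using \<sigma> by simp
      then have "tame_point i m = tame_point i m'" by (rule inj_onD[OF f'(2)]) auto
      then show "m = m'" by (rule injD[OF inj])
    qed
    from injection_extends[OF \<omega> ij this] show ?thesis using \<sigma> by auto
  qed
  ultimately show ?thesis unfolding very_tame_def tame_def by blast
qed

end

lemma Koras_Russell_eq: "Koras_Russell = X_var (\<lambda>z. - ((z $ 1)\<^sup>2 + (z $ 2) ^ 3)) (\<lambda>_. -1)"
  by (auto simp: Koras_Russell_def X_var_def Let_def algebra_simps eq_neg_iff_add_eq_0)

lemma X_var_very_tame:
  fixes a b :: "complex^'n \<Rightarrow> complex"
  assumes "CARD('n) \<ge> 2" "hol_fun_on UNIV a" "hol_fun_on UNIV b"
  shows "(\<exists>\<omega>. is_omega (X_var a b) \<omega>) \<and> (\<forall>\<omega>. is_omega (X_var a b) \<omega> \<longrightarrow> (\<exists>A. very_tame (X_var a b) \<omega> A))"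
proof -
  interpret X_variety a b by unfold_locales (use assms in auto)
  obtain i j :: 'n where "i \<noteq> j"
    using assms(1) card_le_Suc0_iff_eq[of "UNIV :: 'n set"] by (auto simp: numeral_2_eq_2 not_le Suc_le_eq)
  then show ?thesis using is_omega_residue_form very_tame_range_tame_point by blast
qed

theorem corollary5p12:
  fixes n :: nat and a b :: "complex^'n \<Rightarrow> complex"
  shows "(n \<ge> 1 \<and> CARD('n) = n + 1 \<and> hol_fun_on UNIV a \<and> hol_fun_on UNIV b \<longrightarrow>
            (\<exists>\<omega>. is_omega (X_var a b) \<omega>) \<and>
            (\<forall>\<omega>. is_omega (X_var a b) \<omega> \<longrightarrow> (\<exists>A. very_tame (X_var a b) \<omega> A)))
         \<and>
         (\<exists>\<omega>. is_omega Koras_Russell \<omega>) \<and>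
         (\<forall>\<omega>. is_omega Koras_Russell \<omega> \<longrightarrow> (\<exists>A. very_tame Koras_Russell \<omega> A))"
proof -
  have "hol_fun_on UNIV (\<lambda>z :: complex^2. - ((z $ 1)\<^sup>2 + (z $ 2) ^ 3))" "hol_fun_on UNIV (\<lambda>_ :: complex^2. -1)"
    by (intro hol_fun_intros)+
  then show ?thesis
    unfolding Koras_Russell_eq using X_var_very_tame[of a b]
      X_var_very_tame[of "\<lambda>z :: complex^2. - ((z $ 1)\<^sup>2 + (z $ 2) ^ 3)" "\<lambda>_. -1"]
    by simp
qed

end
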